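(* Let $\mathbb{D}$ be a division ring with finite dimension $d$ over a central subfield $\mathbb{F}$. Let $U$ and $V$ be finite-dimensional right $\mathbb{D}$-vector spaces and $S$ be a deeply intransitive $\mathbb{F}$-linear subspace of $\operatorname{Hom}_{\mathbb{D}}(U,V)$. Set $n:=\dim_{\mathbb{D}}V$ and $\alpha(n,d):=n(d-1)+d\binom{n}{2}$. Assume that $|\mathbb{F}|\geq nd$, that $S$ has a right-nondegenerate alternator $b$, and that $\dim_{\mathbb{F}}S\geq\alpha(n,d)-n+\max(4-d,2)$. Then $\mathbb{D}$ has quadratic type over $\mathbb{F}$, and for any associated pair $(\sigma,e)$ the form $b$ equals $(x,y)\mapsto e(B(x,y))$ for a unique right-nondegenerate $\sigma$-sesquilinear form $B$ on $U\times V$; moreover $S\subseteq\mathcal{A}_{b,\mathbb{D}}$.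
   Context: A central subfield of $\mathbb{D}$ is a subfield contained in the center of $\mathbb{D}$. For an $\mathbb{F}$-linear subspace $S$ of $\operatorname{Hom}_{\mathbb{D}}(U,V)$ and $x\in U$, write $Sx:=\{f(x):f\in S\}$. $S$ is intransitive if $Sx\neq V$ for all $x\in U$. For a $\mathbb{D}$-linear subspace $V'$ of $V$, $S^{V'}$ is the set of all $f\in S$ whose range is contained in $V'$. $S$ is deeply intransitive if it is intransitive and, for every nonzero $\mathbb{D}$-linear subspace $V'$ of $V$, $S^{V'}$ is intransitive as an $\mathbb{F}$-linear subspace of $\operatorname{Hom}_{\mathbb{D}}(U,V')$. An alternator of $S$ is an $\mathbb{F}$-bilinear form $b:U\times V\to\mathbb{F}$ such that $b(x,f(x))=0$ for all $x\in U$ and $f\in S$. A form $b$ on $U\times V$ (with values in $\mathbb{F}$ or in $\mathbb{D}$) is right-nondegenerate if $\{y\in V: b(x,y)=0\text{ for all }x\in U\}=\{0\}$. $\mathcal{A}_{b,\mathbb{D}}$ is the set of all $f\in\operatorname{Hom}_{\mathbb{D}}(U,V)$ such that $b(x,f(x))=0$ for all $x\in U$. $\mathbb{D}$ is of quadratic type over $\mathbb{F}$ if one of the following holds: (i) $d=1$; (ii) $d=2$ and $\mathbb{D}$ is a separable field extension of $\mathbb{F}$; (iii) $d=4$ and $\mathbb{D}$ is a quaternion algebra over $\mathbb{F}$; (iv) $d=2^m$ for some $m\geq 1$, $\operatorname{char}(\mathbb{F})=2$, $\mathbb{D}$ is a field and $x^2\in\mathbb{F}$ for all $x\in\mathbb{D}$.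 The standard involution $\sigma$ of $\mathbb{D}$ is the identity of $\mathbb{D}$ in cases (i) and (iv), the non-identity $\mathbb{F}$-automorphism in case (ii), and the quaternionic conjugation in case (iii). An associated pair $(\sigma,e)$ for $\mathbb{D}$ over $\mathbb{F}$ consists of the standard involution $\sigma$ and of an $\mathbb{F}$-linear form $e:\mathbb{D}\to\mathbb{F}$ which is the Galois trace of $\mathbb{D}$ over $\mathbb{F}$ in cases (i) and (ii) (so $e=\operatorname{id}$ if $d=1$), the reduced trace $x\mapsto x+\sigma(x)$ in case (iii), and an arbitrary nonzero $\mathbb{F}$-linear form on $\mathbb{D}$ in case (iv). A $\sigma$-sesquilinear form on $U\times V$ is a map $B:U\times V\to\mathbb{D}$ such that $B(x\alpha+x',y)=\sigma(\alpha)B(x,y)+B(x',y)$ and $B(x,y\alpha+y')=B(x,y)\alpha+B(x,y')$ for all $\alpha\in\mathbb{D}$, $x,x'\in U$, $y,y'\in V$. *)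

theory Defs
  imports
    Main
    "HOL-Library.Function_Algebras"
    "HOL-Computational_Algebra.Polynomial"
    "HOL-Computational_Algebra.Polynomial_Factorial"
begin

section \<open>Division rings over a central subfield\<close>

text \<open>
  The division ring is the type \<open>'d\<close>. A central subfield is given by a field type \<open>'f\<close> and a
  unital ring homomorphism \<open>\<phi> :: 'f \<Rightarrow> 'd\<close> (automatically injective) whose range lies in the
  center; the subfield itself is \<open>range \<phi>\<close>.
\<close>

definition center :: "'d::division_ring set" where
  "center = {z. \<forall>x. z * x = x * z}"

locale central_subfield =
  fixes \<phi> :: "'f::field \<Rightarrow> 'd::division_ring"
  assumes hom_add: "\<phi> (a + b) = \<phi> a + \<phi> b"
    and hom_mult: "\<phi> (a * b) = \<phi> a * \<phi> b"
    and hom_one: "\<phi> 1 = 1"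
    and central: "range \<phi> \<subseteq> center"

definition alg_scale :: "('f::field \<Rightarrow> 'd::division_ring) \<Rightarrow> 'f \<Rightarrow> 'd \<Rightarrow> 'd" where
  "alg_scale \<phi> a x = \<phi> a * x"

definition finite_extension :: "('f::field \<Rightarrow> 'd::division_ring) \<Rightarrow> bool" where
  "finite_extension \<phi> \<longleftrightarrow> (\<exists>B. finite_dimensional_vector_space (alg_scale \<phi>) B)"

definition ext_degree :: "('f::field \<Rightarrow> 'd::division_ring) \<Rightarrow> nat" where
  "ext_degree \<phi> = vector_space.dim (alg_scale \<phi>) UNIV"

definition commutative_ring :: "'d::division_ring itself \<Rightarrow> bool" where
  "commutative_ring _ \<longleftrightarrow> (\<forall>x y :: 'd. x * y = y * x)"

definition ext_eval :: "('f::field \<Rightarrow> 'd::division_ring) \<Rightarrow> 'f poly \<Rightarrow> 'd \<Rightarrow> 'd" where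
  "ext_eval \<phi> p x = (\<Sum>i\<le>degree p. \<phi> (coeff p i) * x ^ i)"

text \<open>
  An irreducible polynomial vanishing at \<open>x\<close> is the minimal polynomial of \<open>x\<close> up to a nonzero
  scalar; it is separable when it is coprime to its derivative.
\<close>

definition separable_extension :: "('f::field \<Rightarrow> 'd::division_ring) \<Rightarrow> bool" where
  "separable_extension \<phi> \<longleftrightarrow>
     (\<forall>x. \<exists>p. irreducible p \<and> ext_eval \<phi> p x = 0 \<and> coprime p (pderiv p))"

definition alg_automorphisms :: "('f::field \<Rightarrow> 'd::division_ring) \<Rightarrow> ('d \<Rightarrow> 'd) set" where
  "alg_automorphisms \<phi> =
     {g. bij g \<and> (\<forall>x y. g (x + y) = g x + g y) \<and> (\<forall>x y. g (x * y) = g x * g y) \<and>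
         (\<forall>a. g (\<phi> a) = \<phi> a)}"

text \<open>
  A quaternion algebra is a central simple algebra of dimension 4; simplicity is automatic for a
  division ring.
\<close>

definition quaternion_algebra :: "('f::field \<Rightarrow> 'd::division_ring) \<Rightarrow> bool" where
  "quaternion_algebra \<phi> \<longleftrightarrow> ext_degree \<phi> = 4 \<and> center = range \<phi>"

text \<open>
  On a quaternion algebra, the quaternionic conjugation is the only \<open>\<phi>\<close>-linear involutory
  anti-automorphism such that \<open>x + \<sigma> x\<close> and \<open>x \<sigma>(x)\<close> are always scalars. This
  description covers characteristic 2.
\<close>

definition quaternionic_conjugation ::
    "('f::field \<Rightarrow> 'd::division_ring) \<Rightarrow> ('d \<Rightarrow> 'd) \<Rightarrow> bool" where
  "quaternionic_conjugation \<phi> \<sigma> \<longleftrightarrow>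
     (\<forall>x y. \<sigma> (x + y) = \<sigma> x + \<sigma> y) \<and> (\<forall>a. \<sigma> (\<phi> a) = \<phi> a) \<and>
     (\<forall>x y. \<sigma> (x * y) = \<sigma> y * \<sigma> x) \<and> (\<forall>x. \<sigma> (\<sigma> x) = x) \<and>
     (\<forall>x. x + \<sigma> x \<in> range \<phi>) \<and> (\<forall>x. x * \<sigma> x \<in> range \<phi>)"


section \<open>Quadratic type and associated pairs\<close>

definition quadratic_type_i :: "('f::field \<Rightarrow> 'd::division_ring) \<Rightarrow> bool" where
  "quadratic_type_i \<phi> \<longleftrightarrow> ext_degree \<phi> = 1"

definition quadratic_type_ii :: "('f::field \<Rightarrow> 'd::division_ring) \<Rightarrow> bool" where
  "quadratic_type_ii \<phi> \<longleftrightarrow>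
     ext_degree \<phi> = 2 \<and> commutative_ring TYPE('d) \<and> separable_extension \<phi>"

definition quadratic_type_iii :: "('f::field \<Rightarrow> 'd::division_ring) \<Rightarrow> bool" where
  "quadratic_type_iii \<phi> \<longleftrightarrow> ext_degree \<phi> = 4 \<and> quaternion_algebra \<phi>"

definition quadratic_type_iv :: "('f::field \<Rightarrow> 'd::division_ring) \<Rightarrow> bool" where
  "quadratic_type_iv \<phi> \<longleftrightarrow>
     (\<exists>m\<ge>1. ext_degree \<phi> = 2 ^ m) \<and> CHAR('f) = 2 \<and> commutative_ring TYPE('d) \<and>
     (\<forall>x. x\<^sup>2 \<in> range \<phi>)"

definition quadratic_type :: "('f::field \<Rightarrow> 'd::division_ring) \<Rightarrow> bool" where
  "quadratic_type \<phi> \<longleftrightarrow>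
     quadratic_type_i \<phi> \<or> quadratic_type_ii \<phi> \<or> quadratic_type_iii \<phi> \<or> quadratic_type_iv \<phi>"

definition standard_involution ::
    "('f::field \<Rightarrow> 'd::division_ring) \<Rightarrow> ('d \<Rightarrow> 'd) \<Rightarrow> bool" where
  "standard_involution \<phi> \<sigma> \<longleftrightarrow>
     (quadratic_type_i \<phi> \<or> quadratic_type_iv \<phi>) \<and> \<sigma> = id \<or>
     quadratic_type_ii \<phi> \<and> \<sigma> \<in> alg_automorphisms \<phi> \<and> \<sigma> \<noteq> id \<or>
     quadratic_type_iii \<phi> \<and> quaternionic_conjugation \<phi> \<sigma>"

text \<open>Used only when the extension is Galois, where the group of automorphisms is finite.\<close>

definition galois_trace ::
    "('f::field \<Rightarrow> 'd::division_ring) \<Rightarrow> ('d \<Rightarrow> 'f) \<Rightarrow> bool" where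
  "galois_trace \<phi> e \<longleftrightarrow> (\<forall>x. \<phi> (e x) = (\<Sum>g\<in>alg_automorphisms \<phi>. g x))"

definition associated_pair ::
    "('f::field \<Rightarrow> 'd::division_ring) \<Rightarrow> ('d \<Rightarrow> 'd) \<Rightarrow> ('d \<Rightarrow> 'f) \<Rightarrow> bool" where
  "associated_pair \<phi> \<sigma> e \<longleftrightarrow>
     standard_involution \<phi> \<sigma> \<and> Vector_Spaces.linear (alg_scale \<phi>) (*) e \<and>
     ((quadratic_type_i \<phi> \<or> quadratic_type_ii \<phi>) \<and> galois_trace \<phi> e \<or>
      quadratic_type_iii \<phi> \<and> (\<forall>x. \<phi> (e x) = x + \<sigma> x) \<or>
      quadratic_type_iv \<phi> \<and> (\<exists>x. e x \<noteq> 0))"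


section \<open>Right vector spaces over a division ring\<close>

text \<open>
  The library's vector spaces have commutative scalars. The notions below follow the
  definitions of \<open>module\<close> and \<open>vector_space\<close>, with scalars acting on the right:
  \<open>s x a\<close> stands for \<open>x a\<close>.
\<close>

locale right_vector_space =
  fixes s :: "'u::ab_group_add \<Rightarrow> 'd::division_ring \<Rightarrow> 'u"
  assumes scale_add_left: "s (x + y) a = s x a + s y a"
    and scale_add_right: "s x (a + b) = s x a + s x b"
    and scale_mult: "s x (a * b) = s (s x a) b"
    and scale_one: "s x 1 = x"

definition right_subspace ::
    "('u::ab_group_add \<Rightarrow> 'd::division_ring \<Rightarrow> 'u) \<Rightarrow> 'u set \<Rightarrow> bool" where
  "right_subspace s W \<longleftrightarrow>
     0 \<in> W \<and> (\<forall>x\<in>W. \<forall>y\<in>W. x + y \<in> W) \<and> (\<forall>x\<in>W. \<forall>a. s x a \<in> W)"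

definition right_span ::
    "('u::ab_group_add \<Rightarrow> 'd::division_ring \<Rightarrow> 'u) \<Rightarrow> 'u set \<Rightarrow> 'u set" where
  "right_span s B = {\<Sum>x\<in>T. s x (c x) | T c. finite T \<and> T \<subseteq> B}"

definition right_independent ::
    "('u::ab_group_add \<Rightarrow> 'd::division_ring \<Rightarrow> 'u) \<Rightarrow> 'u set \<Rightarrow> bool" where
  "right_independent s B \<longleftrightarrow>
     (\<forall>T c. finite T \<and> T \<subseteq> B \<and> (\<Sum>x\<in>T. s x (c x)) = 0 \<longrightarrow> (\<forall>x\<in>T. c x = 0))"

definition right_finite_dimensional ::
    "('u::ab_group_add \<Rightarrow> 'd::division_ring \<Rightarrow> 'u) \<Rightarrow> bool" where
  "right_finite_dimensional s \<longleftrightarrow> (\<exists>B. finite B \<and> right_span s B = UNIV)"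

definition right_dim :: "('u::ab_group_add \<Rightarrow> 'd::division_ring \<Rightarrow> 'u) \<Rightarrow> nat" where
  "right_dim s =
     (if \<exists>B. right_independent s B \<and> right_span s B = UNIV
      then card (SOME B. right_independent s B \<and> right_span s B = UNIV) else 0)"

definition right_hom ::
    "('u::ab_group_add \<Rightarrow> 'd::division_ring \<Rightarrow> 'u) \<Rightarrow> ('v::ab_group_add \<Rightarrow> 'd \<Rightarrow> 'v) \<Rightarrow>
     ('u \<Rightarrow> 'v) set" where
  "right_hom sU sV =
     {f. (\<forall>x y. f (x + y) = f x + f y) \<and> (\<forall>x a. f (sU x a) = sV (f x) a)}"

definition restrict_scale ::
    "('f::field \<Rightarrow> 'd::division_ring) \<Rightarrow> ('u::ab_group_add \<Rightarrow> 'd \<Rightarrow> 'u) \<Rightarrow> 'f \<Rightarrow> 'u \<Rightarrow> 'u" where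
  "restrict_scale \<phi> s a x = s x (\<phi> a)"

definition hom_scale ::
    "('f::field \<Rightarrow> 'd::division_ring) \<Rightarrow> ('v::ab_group_add \<Rightarrow> 'd \<Rightarrow> 'v) \<Rightarrow>
     'f \<Rightarrow> ('u \<Rightarrow> 'v) \<Rightarrow> ('u \<Rightarrow> 'v)" where
  "hom_scale \<phi> sV a f = (\<lambda>x. restrict_scale \<phi> sV a (f x))"

lemma (in central_subfield) vector_space_alg_scale: "vector_space (alg_scale \<phi>)"
  by unfold_locales (simp_all add: alg_scale_def hom_add hom_mult hom_one algebra_simps)

lemma vector_space_restrict_scale:
  assumes "central_subfield \<phi>" and "right_vector_space s"
  shows "vector_space (restrict_scale \<phi> s)"
proof -
  interpret central_subfield \<phi> by fact
  interpret right_vector_space s by fact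
  have "s (s x (\<phi> b)) (\<phi> a) = s x (\<phi> (a * b))" for x a b
    by (metis hom_mult mult.commute scale_mult)
  then show ?thesis
    by unfold_locales
      (simp_all add: restrict_scale_def hom_add hom_one scale_add_left scale_add_right scale_one)
qed

lemma vector_space_hom_scale:
  assumes "central_subfield \<phi>" and "right_vector_space s"
  shows "vector_space (hom_scale \<phi> s)"
proof -
  interpret vector_space "restrict_scale \<phi> s"
    using assms by (rule vector_space_restrict_scale)
  show ?thesis
    by unfold_locales
      (simp_all add: hom_scale_def fun_eq_iff scale_right_distrib scale_left_distrib)
qed


section \<open>Intransitive operator spaces and alternators\<close>

text \<open>\<open>intransitive S W\<close>: the operators in \<open>S\<close> are regarded as having codomain \<open>W\<close>.\<close>

definition intransitive :: "('u \<Rightarrow> 'v) set \<Rightarrow> 'v set \<Rightarrow> bool" where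
  "intransitive S W \<longleftrightarrow> (\<forall>x. {f x | f. f \<in> S} \<noteq> W)"

definition range_within :: "('u \<Rightarrow> 'v) set \<Rightarrow> 'v set \<Rightarrow> ('u \<Rightarrow> 'v) set" where
  "range_within S W = {f \<in> S. range f \<subseteq> W}"

definition deeply_intransitive ::
    "('v::ab_group_add \<Rightarrow> 'd::division_ring \<Rightarrow> 'v) \<Rightarrow> ('u \<Rightarrow> 'v) set \<Rightarrow> bool" where
  "deeply_intransitive sV S \<longleftrightarrow>
     intransitive S UNIV \<and>
     (\<forall>W. right_subspace sV W \<and> W \<noteq> {0} \<longrightarrow> intransitive (range_within S W) W)"

definition bilinear_form ::
    "('f::field \<Rightarrow> 'd::division_ring) \<Rightarrow> ('u::ab_group_add \<Rightarrow> 'd \<Rightarrow> 'u) \<Rightarrow>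
     ('v::ab_group_add \<Rightarrow> 'd \<Rightarrow> 'v) \<Rightarrow> ('u \<Rightarrow> 'v \<Rightarrow> 'f) \<Rightarrow> bool" where
  "bilinear_form \<phi> sU sV b \<longleftrightarrow>
     (\<forall>y. Vector_Spaces.linear (restrict_scale \<phi> sU) (*) (\<lambda>x. b x y)) \<and>
     (\<forall>x. Vector_Spaces.linear (restrict_scale \<phi> sV) (*) (b x))"

definition alternator ::
    "('f::field \<Rightarrow> 'd::division_ring) \<Rightarrow> ('u::ab_group_add \<Rightarrow> 'd \<Rightarrow> 'u) \<Rightarrow>
     ('v::ab_group_add \<Rightarrow> 'd \<Rightarrow> 'v) \<Rightarrow> ('u \<Rightarrow> 'v) set \<Rightarrow> ('u \<Rightarrow> 'v \<Rightarrow> 'f) \<Rightarrow> bool" where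
  "alternator \<phi> sU sV S b \<longleftrightarrow> bilinear_form \<phi> sU sV b \<and> (\<forall>x. \<forall>f\<in>S. b x (f x) = 0)"

definition right_nondegenerate :: "('u \<Rightarrow> 'v::zero \<Rightarrow> 'c::zero) \<Rightarrow> bool" where
  "right_nondegenerate b \<longleftrightarrow> {y. \<forall>x. b x y = 0} = {0}"

definition alternating_homs ::
    "('u::ab_group_add \<Rightarrow> 'd::division_ring \<Rightarrow> 'u) \<Rightarrow> ('v::ab_group_add \<Rightarrow> 'd \<Rightarrow> 'v) \<Rightarrow>
     ('u \<Rightarrow> 'v \<Rightarrow> 'c::zero) \<Rightarrow> ('u \<Rightarrow> 'v) set" where
  "alternating_homs sU sV b = {f \<in> right_hom sU sV. \<forall>x. b x (f x) = 0}"

definition sesquilinear ::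
    "('u::ab_group_add \<Rightarrow> 'd::division_ring \<Rightarrow> 'u) \<Rightarrow> ('v::ab_group_add \<Rightarrow> 'd \<Rightarrow> 'v) \<Rightarrow>
     ('d \<Rightarrow> 'd) \<Rightarrow> ('u \<Rightarrow> 'v \<Rightarrow> 'd) \<Rightarrow> bool" where
  "sesquilinear sU sV \<sigma> B \<longleftrightarrow>
     (\<forall>\<alpha> x x' y. B (sU x \<alpha> + x') y = \<sigma> \<alpha> * B x y + B x' y) \<and>
     (\<forall>\<alpha> x y y'. B x (sV y \<alpha> + y') = B x y * \<alpha> + B x y')"

definition dim_bound :: "nat \<Rightarrow> nat \<Rightarrow> int" where
  "dim_bound n d = int n * (int d - 1) + int d * int (n choose 2)"

end

(*
  For x in U, consider the F-linear forms y |-> b(x a, y a) on V, where a ranges over D. Each of them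
  vanishes on Sx, and an operator in S that vanishes at x maps into a proper D-subspace V_x on which b
  is still nondegenerate. Peeling off one x at a time bounds dim S by alpha(n,d), and
  each step loses an extra dimension when the forms attached to x span more than a line. The
  dimension hypothesis tolerates fewer than n - 1 such losses. So if the forms attached to some x
  span more than a line, then V_x is a hyperplane over which this never happens, by
  induction; two such hyperplanes, obtained from x and x + z t, span V, a contradiction.

  Hence b(x a, y a) = N(a) b(x,y) with N(a) in F. Then tau(a) = N(a)/a is additive and a tau(a) is in F,
  so every element of D is quadratic over F, which forces D to be of quadratic type with standard
  involution tau. Finally b = e o B with B right D-linear in y, and the identity above says that B is
  tau-semilinear in x.
*)

theory Submission
  imports Defs
begin

section \<open>Central subfields and quadratic conjugations\<close>

text \<open>The induction carries a threshold instead of a dimension: \<open>S\<close> must not be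
  spanned by \<open>rank_bound d n + 1 - n\<close> operators. If the forms attached to
  \<open>x\<close> span more than a line, then \<open>S x\<close> has dimension at most
  \<open>n * d - 2\<close>, and the threshold for \<open>n\<close> is exactly
  \<open>n * d - 2\<close> plus the threshold for \<open>n - 1\<close>. So the operators vanishing
  at \<open>x\<close> inherit the same condition on V_x; for \<open>n \<le> 2\<close> that condition
  exceeds the general rank bound, which stops the descent. The final contradiction rests on a
  rigidity: N is the norm of a conjugation of D that D and F alone determine. Two hyperplanes on
  which b(x a, y a) = N(a) b(x,y) thus share one N, and since this identity is additive in y, it
  extends to their sum. The map tau is an adjoint, b(x a, w) = b(x, w tau(a)); its additivity is the
  additivity of b in x. The field size serves to choose t: the minor at x + z t is quadratic in t
  and t = 0 is excluded, so four scalars are required.\<close>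

context central_subfield
begin

lemma hom_zero [simp]: "\<phi> 0 = 0"
  using hom_add[of 0 0] by simp

lemma hom_minus: "\<phi> (- a) = - \<phi> a"
  using hom_add[of a "- a"] by (simp add: eq_neg_iff_add_eq_0 add.commute)

lemma hom_diff: "\<phi> (a - b) = \<phi> a - \<phi> b"
  using hom_add[of a "- b"] by (simp add: hom_minus)

lemma hom_eq_zero_iff [simp]: "\<phi> a = 0 \<longleftrightarrow> a = 0"
proof
  assume "\<phi> a = 0"
  then have "a \<noteq> 0 \<Longrightarrow> \<phi> 1 = 0"
    using hom_mult[of a "inverse a"] by simp
  then show "a = 0"
    using hom_one by auto
qed simp

lemma hom_inverse: "\<phi> (inverse a) = inverse (\<phi> a)"
proof (cases "a = 0")
  case False
  then have "\<phi> a * \<phi> (inverse a) = 1"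
    using hom_mult[of a "inverse a"] by (simp add: hom_one)
  then show ?thesis
    by (metis inverse_unique)
qed simp

lemma inj_hom: "inj \<phi>"
  by (rule injI) (metis hom_diff hom_eq_zero_iff right_minus_eq)

lemma hom_eq_iff [simp]: "\<phi> a = \<phi> b \<longleftrightarrow> a = b"
  using inj_hom by (simp add: inj_eq)

lemma hom_commute: "x * \<phi> a = \<phi> a * x"
proof -
  have "\<phi> a \<in> center"
    using central by blast
  then have "\<forall>y. \<phi> a * y = y * \<phi> a"
    unfolding center_def mem_Collect_eq .
  then have "\<phi> a * x = x * \<phi> a"
    by (rule spec)
  then show ?thesis
    by (rule sym)
qed

lemma hom_left_commute: "x * (\<phi> a * y) = \<phi> a * (x * y)"
  by (metis hom_commute mult.assoc)

lemma range_add: "x \<in> range \<phi> \<Longrightarrow> y \<in> range \<phi> \<Longrightarrow> x + y \<in> range \<phi>"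
  by (auto simp flip: hom_add)

lemma range_diff: "x \<in> range \<phi> \<Longrightarrow> y \<in> range \<phi> \<Longrightarrow> x - y \<in> range \<phi>"
  by (auto simp flip: hom_diff)

lemma range_minus: "x \<in> range \<phi> \<Longrightarrow> - x \<in> range \<phi>"
  by (auto simp flip: hom_minus)

lemma range_mult: "x \<in> range \<phi> \<Longrightarrow> y \<in> range \<phi> \<Longrightarrow> x * y \<in> range \<phi>"
  by (auto simp flip: hom_mult)

lemma range_inverse: "x \<in> range \<phi> \<Longrightarrow> inverse x \<in> range \<phi>"
  by (auto simp flip: hom_inverse)

lemma zero_in_range: "0 \<in> range \<phi>"
  by (metis hom_zero rangeI)

lemma one_in_range: "1 \<in> range \<phi>"
  by (metis hom_one rangeI)

lemma range_commute: "c \<in> range \<phi> \<Longrightarrow> x * c = c * x"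
  by (auto simp: hom_commute)

lemma range_mult_cancel: "c \<in> range \<phi> \<Longrightarrow> c \<noteq> 0 \<Longrightarrow> c * x \<in> range \<phi> \<Longrightarrow> x \<in> range \<phi>"
  using range_mult[of "inverse c" "c * x"] range_inverse[of c] by (simp flip: mult.assoc)

end

text \<open>These axioms are what a tight form yields for its adjoint map. Nothing is postulated
  about products: the trace, the quadratic equation, involutivity and uniqueness all come from
  linearity and the scalar norm.\<close>

locale quadratic_conjugation = central_subfield \<phi>
  for \<phi> :: "'f::field \<Rightarrow> 'd::division_ring" +
  fixes \<tau> :: "'d \<Rightarrow> 'd"
  assumes conj_add: "\<tau> (x + y) = \<tau> x + \<tau> y"
    and conj_scale: "\<tau> (\<phi> a * x) = \<phi> a * \<tau> x"
    and conj_one: "\<tau> 1 = 1"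
    and norm_in_range: "x * \<tau> x \<in> range \<phi>"
begin

definition norm :: "'d \<Rightarrow> 'f" where
  "norm x = inv \<phi> (x * \<tau> x)"

lemma hom_norm: "\<phi> (norm x) = x * \<tau> x"
  using norm_in_range by (simp add: norm_def f_inv_into_f)

lemma conj_hom [simp]: "\<tau> (\<phi> a) = \<phi> a"
  using conj_scale[of a 1] by (simp add: conj_one)

lemma conj_zero [simp]: "\<tau> 0 = 0"
  using conj_hom[of 0] by simp

lemma conj_minus: "\<tau> (- x) = - \<tau> x"
  using conj_add[of x "- x"] by (simp add: eq_neg_iff_add_eq_0 add.commute)

lemma conj_diff: "\<tau> (x - y) = \<tau> x - \<tau> y"
  using conj_add[of x "- y"] by (simp add: conj_minus)

lemma conj_range: "x \<in> range \<phi> \<Longrightarrow> \<tau> x = x"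
  by auto

text \<open>Polarization of the norm between \<open>x\<close> and \<open>1\<close>.\<close>

lemma trace_in_range: "x + \<tau> x \<in> range \<phi>"
proof -
  have "x + \<tau> x = (x + 1) * \<tau> (x + 1) - x * \<tau> x - 1"
    by (simp add: conj_add conj_one algebra_simps)
  then show ?thesis
    by (metis norm_in_range one_in_range range_diff)
qed

definition trace :: "'d \<Rightarrow> 'f" where
  "trace x = inv \<phi> (x + \<tau> x)"

lemma hom_trace: "\<phi> (trace x) = x + \<tau> x"
  using trace_in_range by (simp add: trace_def f_inv_into_f)

lemma conj_eq: "\<tau> x = \<phi> (trace x) - x"
  by (simp add: hom_trace)

lemma square_eq: "x * x = \<phi> (trace x) * x - \<phi> (norm x)"
proof -
  have "x * x = x * \<phi> (trace x) - x * \<tau> x"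
    by (simp add: conj_eq algebra_simps)
  then show ?thesis
    by (simp add: hom_norm hom_commute)
qed

lemma conj_conj: "\<tau> (\<tau> x) = x"
  by (simp add: conj_eq[of x] conj_diff)

lemma polar_in_range: "x * \<tau> y + y * \<tau> x \<in> range \<phi>"
proof -
  have "x * \<tau> y + y * \<tau> x = (x + y) * \<tau> (x + y) - x * \<tau> x - y * \<tau> y"
    by (simp add: conj_add algebra_simps)
  then show ?thesis
    by (metis norm_in_range range_diff)
qed

text \<open>If \<open>x + y\<close> is the scalar \<open>t\<close>, then
  \<open>x * \<tau> x - x * y\<close> is \<open>trace x - t\<close> times \<open>x\<close>. It is
  scalar while \<open>x\<close> is not, so it vanishes and \<open>t\<close> is the trace.\<close>

lemma conj_eqI:
  assumes "x \<notin> range \<phi>" "x + y \<in> range \<phi>" "x * y \<in> range \<phi>"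
  shows "y = \<tau> x"
proof -
  obtain t where t: "x + y = \<phi> t" using assms by auto
  then have y: "y = \<phi> t - x" by (simp add: eq_diff_eq add.commute)
  have "x * \<tau> x - x * y = x * (\<tau> x - y)"
    by (simp add: algebra_simps)
  also have "\<dots> = \<phi> (trace x - t) * x"
    by (simp add: y conj_eq hom_diff hom_commute algebra_simps)
  finally have "\<phi> (trace x - t) * x \<in> range \<phi>"
    by (metis assms(3) norm_in_range range_diff)
  then have "\<phi> (trace x - t) = 0"
    using assms(1) range_mult_cancel by blast
  then show ?thesis
    by (simp add: y conj_eq)
qed

text \<open>Used to identify the conjugations found at different vectors or on different subspaces,
  and to identify \<open>\<tau>\<close> with the quaternionic conjugation.\<close>

lemma conj_unique:
  assumes "quadratic_conjugation \<phi> \<tau>'"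
  shows "\<tau>' = \<tau>"
proof
  fix x
  interpret c': quadratic_conjugation \<phi> \<tau>' by fact
  show "\<tau>' x = \<tau> x"
    by (cases "x \<in> range \<phi>") (auto intro: conj_eqI c'.trace_in_range c'.norm_in_range)
qed

lemma norm_eq_zero_iff: "norm x = 0 \<longleftrightarrow> x = 0"
proof -
  have "\<tau> x = 0 \<Longrightarrow> x = 0"
    using conj_conj[of x] by simp
  then show ?thesis
    using hom_eq_zero_iff[of "norm x"] by (auto simp: hom_norm simp del: hom_eq_zero_iff)
qed

text \<open>\<open>z * x * inverse z\<close> and \<open>z * \<tau> x * inverse z\<close> have the
  same scalar sum and product as \<open>x\<close> and \<open>\<tau> x\<close>, so
  \<open>conj_eqI\<close> makes them conjugate to each other.\<close>

lemma trace_inner_automorphism: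
  assumes "z \<noteq> 0"
  shows "trace (z * x * inverse z) = trace x"
proof (cases "x \<in> range \<phi>")
  case True
  then show ?thesis
    using assms by (simp add: range_commute[of x z] mult.assoc)
next
  case False
  define y where "y = z * x * inverse z"
  have "y \<notin> range \<phi>"
  proof
    assume "y \<in> range \<phi>"
    moreover have "x = inverse z * y * z"
      using assms by (simp add: y_def mult.assoc) (simp flip: mult.assoc)
    ultimately show False
      using False assms by (simp add: range_commute[of y] mult.assoc)
  qed
  moreover have "y + z * \<tau> x * inverse z = z * \<phi> (trace x) * inverse z"
    by (simp add: y_def hom_trace algebra_simps)
  then have sum: "y + z * \<tau> x * inverse z = \<phi> (trace x)"
    using assms by (simp add: hom_commute mult.assoc)
  moreover have "y * (z * \<tau> x * inverse z) = z * (x * \<tau> x) * inverse z"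
  proof -
    have "inverse z * (z * w) = w" for w
      using assms by (simp flip: mult.assoc)
    then show ?thesis
      by (simp add: y_def mult.assoc)
  qed
  then have "y * (z * \<tau> x * inverse z) = \<phi> (norm x)"
    using assms by (simp add: hom_commute mult.assoc flip: hom_norm)
  ultimately have "z * \<tau> x * inverse z = \<tau> y"
    by (metis conj_eqI rangeI)
  then have "\<phi> (trace y) = \<phi> (trace x)"
    unfolding hom_trace[of y] using sum by simp
  then show ?thesis
    by (simp add: y_def)
qed

lemma trace_mult_commute: "trace (x * y) = trace (y * x)"
proof (cases "x = 0")
  case False
  then show ?thesis
    using trace_inner_automorphism[of x "y * x"] by (simp add: mult.assoc)
qed simp

text \<open>With zero trace \<open>\<tau>\<close> is negation, so \<open>1 = - 1\<close> and every
  \<open>x * z + z * x\<close> is scalar. If \<open>c = x * y + y * x\<close> were nonzero, then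
  \<open>c * x\<close>, which is \<open>x * (x * y) + (x * y) * x\<close>, would be scalar too, and
  so would \<open>x\<close>.\<close>

lemma trace_zero_imp_commute:
  fixes x y :: 'd
  assumes "\<And>z. trace z = 0"
  shows "x * y = y * x"
proof (rule ccontr)
  assume ne: "x * y \<noteq> y * x"
  have conj: "\<tau> z = - z" for z
    using conj_eq[of z] assms by simp
  have "1 = - (1::'d)"
    using conj[of 1] by (simp add: conj_one)
  then have neg: "- z = z" for z :: 'd
    by (metis mult_1 mult_minus_left)
  have anti: "x * z + z * x \<in> range \<phi>" for z :: 'd
    using polar_in_range[of x z] conj neg by simp
  define c where "c = x * y + y * x"
  have c: "c \<in> range \<phi>" "c \<noteq> 0"
    using anti[of y] ne neg[of "y * x"] by (auto simp: c_def add_eq_0_iff2)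
  have "c * x = x * (x * y) + (x * y) * x"
    using range_commute[OF c(1), of x] by (simp add: c_def algebra_simps)
  then have "x \<in> range \<phi>"
    using anti[of "x * y"] c range_mult_cancel by metis
  then show False
    using ne range_commute[of x y] by simp
qed

lemma conj_id_if_trace_zero:
  assumes "\<And>x. trace x = 0"
  shows "\<tau> = id" "x * x \<in> range \<phi>" "(2::'f) = 0"
proof -
  have conj: "\<tau> z = - z" for z
    using conj_eq[of z] assms by simp
  have one: "1 = - (1::'d)"
    using conj[of 1] by (simp add: conj_one)
  then have neg: "- z = z" for z :: 'd
    by (metis mult_1 mult_minus_left)
  show id: "\<tau> = id"
    using conj neg by auto
  show "x * x \<in> range \<phi>"
    using norm_in_range[of x] id by simp
  have "\<phi> (1 + 1) = 0"
    unfolding hom_add hom_one using one by (metis add.right_inverse)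
  then have "1 + 1 = (0::'f)"
    by (simp only: hom_eq_zero_iff)
  then show "(2::'f) = 0"
    by (metis one_add_one)
qed

end

text \<open>\<open>L\<close> and \<open>L * g\<close> meet in 0 and have the same dimension. The
  degrees 4 and \<open>2 ^ m\<close> arise from such doublings, starting at the subfield.\<close>

lemma (in central_subfield) dim_double:
  assumes "finite_dimensional_vector_space (alg_scale \<phi>) E"
    and L: "module.subspace (alg_scale \<phi>) L" and g: "g \<noteq> 0"
    and disj: "\<And>x. x \<in> L \<Longrightarrow> x * g \<in> L \<Longrightarrow> x = 0"
  shows "vector_space.dim (alg_scale \<phi>) {x + y * g |x y. x \<in> L \<and> y \<in> L}
           = 2 * vector_space.dim (alg_scale \<phi>) L"
proof -
  interpret DF: finite_dimensional_vector_space "alg_scale \<phi>" E by fact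
  interpret P: finite_dimensional_vector_space_pair_1 "alg_scale \<phi>" E "alg_scale \<phi>"
    by unfold_locales
  have lin: "Vector_Spaces.linear (alg_scale \<phi>) (alg_scale \<phi>) (\<lambda>y. y * g)"
    by unfold_locales (simp_all add: alg_scale_def algebra_simps)
  interpret lin: Vector_Spaces.linear "alg_scale \<phi>" "alg_scale \<phi>" "\<lambda>y. y * g" by fact
  have "inj_on (\<lambda>y. y * g) (DF.span L)"
    using g by (simp add: inj_on_def)
  then have dim_img: "DF.dim ((\<lambda>y. y * g) ` L) = DF.dim L"
    using P.dim_image_eq[OF lin] by blast
  have "L \<inter> (\<lambda>y. y * g) ` L \<subseteq> {0}"
    using disj by auto
  then have "DF.dim (L \<inter> (\<lambda>y. y * g) ` L) = 0"
    unfolding DF.dim_eq_0 .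
  moreover have "{x + y |x y. x \<in> L \<and> y \<in> (\<lambda>y. y * g) ` L} = {x + y * g |x y. x \<in> L \<and> y \<in> L}"
    by blast
  ultimately show ?thesis
    using DF.dim_sums_Int[OF L lin.subspace_image[OF L]] dim_img by presburger
qed

section \<open>The subalgebra generated by one element\<close>

context quadratic_conjugation
begin

text \<open>Because \<open>u\<close> is quadratic over the subfield \<open>F\<close>, this is the
  subalgebra \<open>F[u]\<close>; it collapses to \<open>F\<close> when \<open>u\<close> is
  scalar.\<close>

definition plane :: "'d \<Rightarrow> 'd set" where
  "plane u = {x + y * u |x y. x \<in> range \<phi> \<and> y \<in> range \<phi>}"

lemma planeI: "\<phi> a + \<phi> b * u \<in> plane u"
  unfolding plane_def by blast

lemma range_subset_plane: "range \<phi> \<subseteq> plane u"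
  using planeI[of _ 0 u] by auto

lemma in_plane: "u \<in> plane u"
  using planeI[of 0 1 u] by (simp add: hom_one)

lemma plane_add: "x \<in> plane u \<Longrightarrow> y \<in> plane u \<Longrightarrow> x + y \<in> plane u"
proof -
  assume "x \<in> plane u" "y \<in> plane u"
  then obtain a b a' b' where "x = \<phi> a + \<phi> b * u" "y = \<phi> a' + \<phi> b' * u"
    unfolding plane_def by blast
  then have "x + y = \<phi> (a + a') + \<phi> (b + b') * u"
    by (simp add: hom_add algebra_simps)
  then show ?thesis
    unfolding plane_def by blast
qed

lemma plane_scale: "x \<in> plane u \<Longrightarrow> \<phi> c * x \<in> plane u"
proof -
  assume "x \<in> plane u"
  then obtain a b where "x = \<phi> a + \<phi> b * u"
    unfolding plane_def by blast
  then have "\<phi> c * x = \<phi> (c * a) + \<phi> (c * b) * u"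
    by (simp add: hom_mult distrib_left mult.assoc)
  then show ?thesis
    unfolding plane_def by blast
qed

lemma plane_diff: "x \<in> plane u \<Longrightarrow> y \<in> plane u \<Longrightarrow> x - y \<in> plane u"
  using plane_add[of x u "\<phi> (-1) * y"] plane_scale[of y u "-1"] by (simp add: hom_minus hom_one)

lemma plane_mult: "x \<in> plane u \<Longrightarrow> y \<in> plane u \<Longrightarrow> x * y \<in> plane u"
proof -
  assume x: "x \<in> plane u" and y: "y \<in> plane u"
  have u: "u * u \<in> plane u"
    unfolding square_eq[of u]
    by (intro plane_diff plane_scale in_plane) (use range_subset_plane in blast)
  obtain a b where ab: "x = \<phi> a + \<phi> b * u"
    using x unfolding plane_def by blast
  obtain a' b' where "y = \<phi> a' + \<phi> b' * u"
    using y unfolding plane_def by blast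
  then have "x * y = \<phi> a * y + \<phi> b * (\<phi> a' * u + \<phi> b' * (u * u))"
    by (simp add: ab distrib_left distrib_right mult.assoc
        hom_commute[of u] hom_left_commute[of u])
  then show ?thesis
    using u y by (simp add: plane_add plane_scale in_plane)
qed

lemma subspace_plane: "module.subspace (alg_scale \<phi>) (plane u)"
proof -
  interpret vector_space "alg_scale \<phi>" by (rule vector_space_alg_scale)
  show ?thesis
    using range_subset_plane[of u] zero_in_range
    by (auto simp: subspace_def alg_scale_def intro: plane_add plane_scale)
qed

lemma commute_plane: "x \<in> plane u \<Longrightarrow> x * u = u * x"
  by (auto simp: plane_def distrib_left distrib_right mult.assoc hom_commute[of u] hom_left_commute[of u])

lemma anti_square: "(u - \<tau> u) * (u - \<tau> u) \<in> range \<phi>"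
proof -
  define w where "w = u - \<tau> u"
  have "\<tau> w = - w"
    by (simp add: w_def conj_diff conj_conj)
  then have "w * w = - (w * \<tau> w)"
    by simp
  then show ?thesis
    by (metis norm_in_range range_minus w_def)
qed

lemma conj_in_plane: "\<tau> u \<in> plane u"
  using plane_diff[OF subsetD[OF range_subset_plane rangeI] in_plane] conj_eq by metis

text \<open>\<open>w = u - \<tau> u\<close> has a scalar square \<open>m\<close>, so its inverse is
  \<open>w\<close> divided by \<open>m\<close>. For \<open>w = 0\<close> the convention
  \<open>inverse 0 = 0\<close> keeps the claim true.\<close>

lemma anti_inverse_in_plane: "inverse (u - \<tau> u) \<in> plane u"
proof (cases "u - \<tau> u = 0")
  case True
  show ?thesis
    using subsetD[OF range_subset_plane zero_in_range] by (simp only: True inverse_zero)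
next
  case False
  define w where "w = u - \<tau> u"
  obtain m where m: "w * w = \<phi> m"
    using anti_square[of u] by (auto simp: w_def)
  have "w * w \<noteq> 0"
    using False by (simp add: w_def)
  then have "m \<noteq> 0"
    using m by auto
  have "inverse (\<phi> m) = inverse w * inverse w"
    using m nonzero_inverse_mult_distrib[of w w] False by (metis w_def)
  then have "inverse w = \<phi> (inverse m) * w"
    using False by (simp add: hom_inverse mult.assoc w_def)
  then show ?thesis
    by (simp add: w_def plane_scale plane_diff in_plane conj_in_plane)
qed

text \<open>When \<open>y\<close> commutes with \<open>u\<close>, the scalar
  \<open>u * \<tau> y + y * \<tau> u\<close> equals \<open>trace y\<close> times \<open>u\<close>,
  minus \<open>y * (u - \<tau> u)\<close>. So \<open>y * (u - \<tau> u)\<close> lies in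
  \<open>F[u]\<close>, and dividing by \<open>u - \<tau> u\<close> stays there. Hence
  \<open>F[u]\<close> is its own centralizer.\<close>

lemma commute_imp_in_plane:
  assumes comm: "u * y = y * u" and ne: "u \<noteq> \<tau> u"
  shows "y \<in> plane u"
proof -
  have "y * (u - \<tau> u) = \<phi> (trace y) * u - (u * \<tau> y + y * \<tau> u)"
    by (simp add: conj_eq comm hom_commute[of u] hom_commute[of y] algebra_simps)
  also have "\<dots> \<in> plane u"
    using polar_in_range range_subset_plane by (intro plane_diff plane_scale in_plane) blast
  finally have "y * (u - \<tau> u) * inverse (u - \<tau> u) \<in> plane u"
    using plane_mult anti_inverse_in_plane by blast
  then show ?thesis
    using ne by (simp add: mult.assoc)
qed

text \<open>Outside characteristic 2 a fixed element is half its trace, so the nonscalar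
  \<open>v\<close> is moved. In characteristic 2, \<open>z + z = 0\<close> while the trace of
  \<open>z\<close> is nonzero, so \<open>z\<close> is moved, and therefore not scalar.\<close>

lemma exists_nonfixed:
  assumes "trace z \<noteq> 0" "v \<notin> range \<phi>"
  obtains u where "u \<notin> range \<phi>" "u \<noteq> \<tau> u"
proof -
  have fixed: "u \<in> range \<phi>" if "\<tau> u = u" "(2::'f) \<noteq> 0" for u
  proof -
    have "\<phi> 2 * u = u + \<tau> u"
      using that(1) by (metis hom_add hom_one mult_2 one_add_one distrib_right mult_1)
    then show ?thesis
      using that(2) trace_in_range range_mult_cancel[of "\<phi> 2" u] by auto
  qed
  show ?thesis
  proof (cases "(2::'f) = 0")
    case False
    then show ?thesis
      using that[of v] fixed[of v] assms(2) by metis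
  next
    case True
    have "z + z = \<phi> 2 * z"
      by (metis hom_add hom_one one_add_one distrib_right mult_1)
    then have z: "z + z = 0"
      using True by simp
    have "\<tau> z \<noteq> z"
      using z assms(1) hom_trace[of z] by auto
    then show ?thesis
      using that[of z] conj_range[of z] by metis
  qed
qed

end

section \<open>Division algebras with a quadratic conjugation\<close>

context quadratic_conjugation
begin

text \<open>Everything commutes with \<open>u\<close>, so the division ring is \<open>F[u]\<close>.
  Separability reflects the fact that \<open>\<tau>\<close> moves every nonscalar element.\<close>

lemma quadratic_type_ii_if_commutative:
  assumes comm: "\<And>x y :: 'd. x * y = y * x" and d: "ext_degree \<phi> \<noteq> 1"
    and fin: "finite_dimensional_vector_space (alg_scale \<phi>) E"
    and u: "u \<notin> range \<phi>" "u \<noteq> \<tau> u"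
  shows "quadratic_type_ii \<phi>"
proof -
  interpret DF: finite_dimensional_vector_space "alg_scale \<phi>" E by fact
  have all: "y \<in> plane u" for y
    using commute_imp_in_plane[of u y] comm u(2) by blast
  have "\<phi> a + \<phi> b * u \<in> DF.span {1, u}" for a b
    using DF.span_add[OF DF.span_scale[of 1 "{1, u}" a] DF.span_scale[of u "{1, u}" b]]
    by (simp add: DF.span_base alg_scale_def)
  then have "y \<in> DF.span {1, u}" for y
    using all[of y] unfolding plane_def by blast
  then have "UNIV \<subseteq> DF.span {1, u}"
    by blast
  then have "DF.dim UNIV \<le> card {1, u}"
    by (rule DF.dim_le_card) simp
  also have "\<dots> \<le> 2"
    by (simp add: card_insert_if)
  finally have "DF.dim UNIV \<le> 2" .
  moreover have "DF.dim UNIV \<noteq> 0"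
  proof
    assume "DF.dim UNIV = 0"
    then have "(1::'d) \<in> {0}"
      unfolding DF.dim_eq_0 by blast
    then show False by simp
  qed
  ultimately have two: "ext_degree \<phi> = 2"
    using d unfolding ext_degree_def by linarith
  have nonfixed: "\<tau> x \<noteq> x" if "x \<notin> range \<phi>" for x
  proof -
    obtain a b where x: "x = \<phi> a + \<phi> b * u"
      using all[of x] unfolding plane_def by blast
    then have "x - \<tau> x = \<phi> b * (u - \<tau> u)"
      by (simp add: conj_add conj_scale algebra_simps)
    moreover have "b \<noteq> 0"
      using that x by auto
    ultimately show ?thesis
      using u(2) by auto
  qed
  have "\<exists>p. irreducible p \<and> ext_eval \<phi> p x = 0 \<and> coprime p (pderiv p)" for x
  proof (cases "x \<in> range \<phi>")
    case True
    then obtain a where a: "x = \<phi> a" by auto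
    have "irreducible [:-a, 1:]"
      by (rule irreducible_linear_field_poly) simp
    moreover have "ext_eval \<phi> [:-a, 1:] x = 0"
      by (simp add: ext_eval_def a hom_minus hom_one)
    moreover have "pderiv [:-a, 1:] = 1"
      by (simp add: pderiv_pCons)
    ultimately show ?thesis
      by (metis coprime_1_right)
  next
    case False
    \<comment> \<open>The polynomial of \<open>square_eq\<close>, which vanishes at
      \<open>x\<close>.\<close>
    define p where "p = [:norm x, - trace x, 1:]"
    have deg: "degree p = 2"
      by (simp add: p_def)
    have root: "poly p a \<noteq> 0" for a
    proof
      assume "poly p a = 0"
      then have "norm x - a * trace x + a * a = 0"
        by (simp add: p_def algebra_simps)
      then have n: "\<phi> (norm x) = \<phi> a * \<phi> (trace x) - \<phi> a * \<phi> a"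
        by (simp flip: hom_mult hom_diff add: algebra_simps)
      \<comment> \<open>A scalar root \<open>a\<close> comes with the second root
        \<open>trace x - a\<close>; the polynomial then splits and forces \<open>x\<close> to be one
        of these two scalars.\<close>
      have "(x - \<phi> a) * (x - (\<phi> (trace x) - \<phi> a)) = 0"
        using square_eq[of x] n
        by (simp add: algebra_simps hom_commute[of x] flip: hom_mult)
      then have "x = \<phi> a \<or> x = \<phi> (trace x - a)"
        by (auto simp: hom_diff)
      then show False
        using False by auto
    qed
    have irr: "irreducible p"
    proof (rule irreducibleI)
      show "p \<noteq> 0"
        using deg by auto
      then show "\<not> is_unit p"
        using deg by (metis is_unit_iff_degree zero_neq_numeral)
      fix q r assume qr: "p = q * r"
      have "q \<noteq> 0" "r \<noteq> 0"
        using qr deg by auto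
      then have sum: "degree q + degree r = 2"
        using qr deg degree_mult_eq by metis
      have no1: "degree s \<noteq> 1" if "s dvd p" for s
      proof
        assume "degree s = 1"
        then obtain c e where s: "s = [:c, e:]" "e \<noteq> 0"
          by (rule degree1_coeffs) auto
        have "poly s (- c / e) = 0"
          using s by simp
        then have "poly p (- c / e) = 0"
          using that by (metis dvd_def mult_zero_left poly_mult)
        then show False
          using root by blast
      qed
      have "degree q \<noteq> 1"
        using no1 qr by simp
      then have "degree q = 0 \<or> degree r = 0"
        using sum by linarith
      then show "is_unit q \<or> is_unit r"
        using \<open>q \<noteq> 0\<close> \<open>r \<noteq> 0\<close> by (auto simp: is_unit_iff_degree)
    qed
    have "\<phi> (trace x) \<noteq> x + x"
      using nonfixed[OF False] by (auto simp: hom_trace)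
    have deriv: "pderiv p = [:- trace x, 2:]"
      by (simp add: p_def pderiv_pCons)
    \<comment> \<open>If the derivative vanished, \<open>trace x\<close> and \<open>x + x\<close>
      would both be 0, which means that \<open>\<tau>\<close> fixes \<open>x\<close>.\<close>
    have "pderiv p \<noteq> 0"
    proof
      assume "pderiv p = 0"
      then have "trace x = 0" "(2::'f) = 0"
        by (simp_all add: deriv)
      moreover have "x + x = \<phi> 2 * x"
        by (metis hom_add hom_one one_add_one distrib_right mult_1)
      ultimately show False
        using \<open>\<phi> (trace x) \<noteq> x + x\<close> by simp
    qed
    moreover have "degree (pderiv p) < degree p"
      unfolding deg deriv by simp
    ultimately have "\<not> p dvd pderiv p"
      using dvd_imp_degree_le leD by blast
    then have "coprime p (pderiv p)"
      using irr by (metis coprimeI irreducibleD' dvd_trans)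
    moreover have "ext_eval \<phi> p x = 0"
      using square_eq[of x] unfolding ext_eval_def deg
      by (simp add: p_def numeral_2_eq_2 hom_minus hom_one)
    ultimately show ?thesis
      using irr by blast
  qed
  then show ?thesis
    using two comm by (auto simp: quadratic_type_ii_def commutative_ring_def separable_extension_def)
qed

text \<open>Commutators with \<open>u\<close> intertwine \<open>u\<close> and
  \<open>\<tau> u\<close>. A nonzero one, \<open>g\<close>, gives the Cayley-Dickson decomposition
  of the division ring into \<open>F[u]\<close> and \<open>F[u] * g\<close>.\<close>

lemma quaternion_if_noncommutative:
  fixes p q :: 'd
  assumes ne: "p * q \<noteq> q * p"
    and fin: "finite_dimensional_vector_space (alg_scale \<phi>) E"
    and u: "u \<notin> range \<phi>" "u \<noteq> \<tau> u"
  shows "quadratic_type_iii \<phi>"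
proof -
  interpret DF: finite_dimensional_vector_space "alg_scale \<phi>" E by fact
  define w where "w = u - \<tau> u"
  have "w \<noteq> 0"
    using u by (simp add: w_def)
  have w_plane: "w \<in> plane u"
    by (simp add: w_def plane_diff in_plane conj_in_plane)
  have "\<exists>y. u * y \<noteq> y * u"
  proof (rule ccontr)
    assume "\<nexists>y. u * y \<noteq> y * u"
    then have all: "y \<in> plane u" for y
      using commute_imp_in_plane u(2) by blast
    obtain a b where p: "p = \<phi> a + \<phi> b * u"
      using all[of p] unfolding plane_def by blast
    show False
      using ne commute_plane[OF all[of q]]
      by (simp add: p distrib_left distrib_right mult.assoc hom_commute[of q] hom_left_commute[of q])
  qed
  then obtain y where y: "u * y \<noteq> y * u" by blast
  \<comment> \<open>The difference of both sides is the commutator of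
    \<open>u * u - \<phi> (trace u) * u\<close> with \<open>z\<close>, and this element is the
    scalar \<open>- \<phi> (norm u)\<close>.\<close>
  have flip: "u * (u * z - z * u) = (u * z - z * u) * \<tau> u" for z
  proof -
    have "u * (u * z - z * u) - (u * z - z * u) * \<tau> u
        = (u * u - \<phi> (trace u) * u) * z - z * (u * u - \<phi> (trace u) * u)"
      by (simp add: conj_eq algebra_simps hom_commute[of u] hom_commute[of z]
          hom_left_commute[of u] hom_left_commute[of z])
    also have "\<dots> = 0"
      by (simp add: square_eq[of u] hom_commute[of z])
    finally show ?thesis by simp
  qed
  define g where "g = u * y - y * u"
  have g: "g \<noteq> 0" "u * g = g * \<tau> u"
    using y flip[of y] by (auto simp: g_def)
  have g': "\<tau> u * g = g * u"
    using g(2) by (simp add: conj_eq algebra_simps hom_commute[of g])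
  have decomposition: "\<exists>l\<in>plane u. \<exists>m\<in>plane u. z = l + m * g" for z
  proof -
    define h where "h = u * z - z * u"
    have inv: "inverse g * u = \<tau> u * inverse g"
    proof -
      have "inverse g * (g * \<tau> u) * inverse g = inverse g * (u * g) * inverse g"
        by (simp only: g)
      moreover have "inverse g * (g * x) = x" for x
        using g(1) by (simp flip: mult.assoc)
      moreover have "inverse g * (u * g) * inverse g = inverse g * u"
        using g(1) by (simp add: mult.assoc)
      ultimately show ?thesis
        by metis
    qed
    \<comment> \<open>Moving \<open>u\<close> across \<open>h\<close> or across \<open>g\<close>
      replaces it by \<open>\<tau> u\<close>; the two changes cancel in the quotient.\<close>
    have "u * (h * inverse g) = h * inverse g * u"
      using flip[of z] by (simp add: h_def inv mult.assoc) (simp flip: mult.assoc)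
    then have k: "h * inverse g \<in> plane u"
      using commute_imp_in_plane u(2) by blast
    \<comment> \<open>Solves for the coefficient of \<open>g\<close>: the commutator of
      \<open>u\<close> with \<open>m * g\<close> is \<open>m * w * g\<close>, and it has to be
      \<open>h\<close>, the commutator of \<open>u\<close> with \<open>z\<close>.\<close>
    define m where "m = inverse w * (h * inverse g)"
    have m: "m \<in> plane u"
      using plane_mult[OF anti_inverse_in_plane k] by (simp add: m_def w_def)
    have "u * (m * g) - m * g * u = m * (u * g - \<tau> u * g)"
      using commute_plane[OF m] by (simp add: g' algebra_simps) (simp flip: mult.assoc)
    also have "\<dots> = m * w * g"
      by (simp add: w_def algebra_simps)
    also have "m * w = w * m"
    proof -
      obtain a b where ab: "w = \<phi> a + \<phi> b * u"
        using w_plane unfolding plane_def by blast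
      show ?thesis
        using commute_plane[OF m]
        by (simp add: ab distrib_left distrib_right mult.assoc hom_commute[of m] hom_left_commute[of m])
    qed
    also have "w * m * g = h"
    proof -
      have "w * (inverse w * x) = x" for x
        using \<open>w \<noteq> 0\<close> by (simp flip: mult.assoc)
      then show ?thesis
        using g(1) by (simp add: m_def mult.assoc)
    qed
    finally have "u * (z - m * g) = (z - m * g) * u"
      by (simp add: h_def algebra_simps)
    then have "z - m * g \<in> plane u"
      using commute_imp_in_plane u(2) by blast
    then show ?thesis
      using m by (metis diff_add_cancel)
  qed
  \<comment> \<open>Both \<open>x\<close> and \<open>x * g\<close> commute with \<open>u\<close>,
    whereas moving \<open>u\<close> across \<open>g\<close> conjugates it; hence
    \<open>x * g\<close> annihilates \<open>u - \<tau> u\<close>.\<close>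
  have disjoint: "x = 0" if "x \<in> plane u" "x * g \<in> plane u" for x
  proof -
    have "x * g * u = u * (x * g)"
      using commute_plane[OF that(2)] .
    also have "\<dots> = x * (u * g)"
      using commute_plane[OF that(1)] by (simp flip: mult.assoc)
    finally have "x * (g * (u - \<tau> u)) = 0"
      by (simp add: g algebra_simps)
    then show ?thesis
      using g(1) u(2) by simp
  qed
  have dim4: "DF.dim {x + y * g |x y. x \<in> plane u \<and> y \<in> plane u} = 2 * DF.dim (plane u)"
    by (rule dim_double[OF fin subspace_plane g(1) disjoint])
  have "{x + y * g |x y. x \<in> plane u \<and> y \<in> plane u} = UNIV"
    using decomposition by blast
  then have "DF.dim UNIV = 2 * DF.dim (plane u)"
    using dim4 by metis
  moreover have "DF.dim (plane u) = 2 * DF.dim (range \<phi>)"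
    unfolding plane_def
  proof (rule dim_double[OF fin])
    show "DF.subspace (range \<phi>)"
      using zero_in_range by (auto simp: DF.subspace_def alg_scale_def intro: range_add range_mult)
    show "u \<noteq> 0"
      using u(1) zero_in_range by blast
    show "x = 0" if "x \<in> range \<phi>" "x * u \<in> range \<phi>" for x
      using that u(1) range_mult_cancel by blast
  qed
  moreover have "DF.dim (range \<phi>) = 1"
  proof -
    have "range \<phi> = DF.span {1}"
      by (simp add: DF.span_singleton alg_scale_def)
    then show ?thesis
      by simp
  qed
  ultimately have four: "ext_degree \<phi> = 4"
    by (simp add: ext_degree_def)
  have "center = range \<phi>"
  proof
    show "center \<subseteq> range \<phi>"
    proof
      fix z :: 'd assume "z \<in> center"
      then have "\<forall>y. z * y = y * z"
        unfolding center_def mem_Collect_eq .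
      then have z: "z * y = y * z" for y by blast
      have "z \<in> plane u"
        using z[of u] by (intro commute_imp_in_plane u(2)) (rule sym)
      then obtain a b where ab: "z = \<phi> a + \<phi> b * u"
        unfolding plane_def by blast
      have "\<phi> b * (u * y - y * u) = 0"
        using z[of y] by (simp add: ab distrib_left distrib_right right_diff_distrib mult.assoc
            hom_commute[of y] hom_left_commute[of y])
      then have "b = 0"
        using y by simp
      then show "z \<in> range \<phi>"
        by (simp add: ab)
    qed
  qed (rule central)
  then show ?thesis
    using four by (simp add: quadratic_type_iii_def quaternion_algebra_def)
qed

text \<open>Squares are scalar and multiplication is commutative, so adjoining any \<open>g\<close>
  outside a subfield of degree \<open>2 ^ k\<close> doubles its degree. Unless the whole ring is
  reached at some stage, this continues beyond its finite degree.\<close>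

lemma quadratic_type_iv_if_trace_zero:
  assumes T: "\<And>z. trace z = 0" and d: "ext_degree \<phi> \<noteq> 1"
    and fin: "finite_dimensional_vector_space (alg_scale \<phi>) E"
  shows "quadratic_type_iv \<phi>"
proof -
  interpret DF: finite_dimensional_vector_space "alg_scale \<phi>" E by fact
  note comm = trace_zero_imp_commute[OF T]
  note sq = conj_id_if_trace_zero(2)[OF T]
  have "\<exists>m. ext_degree \<phi> = 2 ^ m"
  proof (rule ccontr)
    assume no: "\<nexists>m. ext_degree \<phi> = 2 ^ m"
    have "\<exists>L. DF.subspace L \<and> range \<phi> \<subseteq> L \<and> (\<forall>x\<in>L. \<forall>y\<in>L. x * y \<in> L) \<and> DF.dim L = 2 ^ k" for k
    proof (induction k)
      case 0
      have "range \<phi> = DF.span {1}"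
        by (simp add: DF.span_singleton alg_scale_def)
      then have "DF.subspace (range \<phi>) \<and> DF.dim (range \<phi>) = 2 ^ 0"
        by simp
      then show ?case
        using range_mult by blast
    next
      case (Suc k)
      then obtain L where L: "DF.subspace L" "range \<phi> \<subseteq> L" "DF.dim L = 2 ^ k"
        and mult: "\<And>x y. x \<in> L \<Longrightarrow> y \<in> L \<Longrightarrow> x * y \<in> L"
        by blast
      have "L \<noteq> UNIV"
        using L(3) no by (auto simp: ext_degree_def)
      then obtain g where g: "g \<notin> L" by blast
      define L' where "L' = {x + y * g |x y. x \<in> L \<and> y \<in> L}"
      have gg: "g * g \<in> L"
        using sq L(2) by blast
      \<comment> \<open>A nonzero \<open>x\<close> has a nonzero scalar square, so it can be
        inverted inside \<open>L\<close>; then \<open>x * g\<close> in \<open>L\<close> would put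
        \<open>g\<close> in \<open>L\<close>.\<close>
      have "x = 0" if "x \<in> L" "x * g \<in> L" for x
      proof (rule ccontr)
        assume "x \<noteq> 0"
        have xx: "x * x \<in> range \<phi>" "x * x \<noteq> 0"
          using sq \<open>x \<noteq> 0\<close> by auto
        have "inverse (x * x) * (x * (x * g)) \<in> L"
          using mult that range_inverse[OF xx(1)] L(2) by blast
        also have "inverse (x * x) * (x * (x * g)) = g"
        proof -
          have "inverse (x * x) * (x * (x * g)) = inverse (x * x) * (x * x) * g"
            by (simp only: mult.assoc)
          then show ?thesis
            by (simp only: left_inverse[OF xx(2)] mult_1)
        qed
        finally show False
          using g by simp
      qed
      moreover have "g \<noteq> 0"
        using g DF.subspace_0[OF L(1)] by blast
      ultimately have "DF.dim L' = 2 ^ Suc k"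
        using dim_double[OF fin L(1)] L(3) by (simp add: L'_def)
      moreover have "DF.subspace L'"
        unfolding DF.subspace_def
      proof (intro conjI ballI allI)
        show "0 \<in> L'"
          using DF.subspace_0[OF L(1)] by (force simp: L'_def)
        fix v assume "v \<in> L'"
        then obtain x y where v: "v = x + y * g" "x \<in> L" "y \<in> L"
          unfolding L'_def by blast
        show "alg_scale \<phi> c v \<in> L'" for c
        proof -
          have "alg_scale \<phi> c v = alg_scale \<phi> c x + alg_scale \<phi> c y * g"
            by (simp add: v alg_scale_def algebra_simps)
          then show ?thesis
            using v L(1) unfolding L'_def by (blast intro: DF.subspace_scale)
        qed
        fix v' assume "v' \<in> L'"
        then obtain x' y' where v': "v' = x' + y' * g" "x' \<in> L" "y' \<in> L"
          unfolding L'_def by blast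
        have "v + v' = (x + x') + (y + y') * g"
          by (simp add: v v' algebra_simps)
        then show "v + v' \<in> L'"
          using v v' L(1) unfolding L'_def by (blast intro: DF.subspace_add)
      qed
      moreover have "x + 0 * g \<in> L'" if "x \<in> L" for x
        unfolding L'_def using that DF.subspace_0[OF L(1)] by blast
      then have "range \<phi> \<subseteq> L'"
        using L(2) by auto
      moreover have "v * v' \<in> L'" if vL: "v \<in> L'" "v' \<in> L'" for v v'
      proof -
        obtain x y where v: "v = x + y * g" "x \<in> L" "y \<in> L"
          using vL(1) unfolding L'_def by blast
        obtain x' y' where v': "v' = x' + y' * g" "x' \<in> L" "y' \<in> L"
          using vL(2) unfolding L'_def by blast
        have "g * x' = x' * g"
          using comm[of g x'] .
        moreover have "g * (y' * g) = y' * (g * g)"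
          by (simp only: mult.assoc[symmetric] comm[of g y'])
        ultimately have "v * v' = (x * x' + y * (y' * (g * g))) + (x * y' + y * x') * g"
          by (simp only: v v' distrib_left distrib_right mult.assoc add_ac)
        moreover have "x * x' + y * (y' * (g * g)) \<in> L" "x * y' + y * x' \<in> L"
          by (intro DF.subspace_add[OF L(1)] mult v v' gg)+
        ultimately show ?thesis
          unfolding L'_def by blast
      qed
      ultimately show ?case by blast
    qed
    \<comment> \<open>The stage \<open>k = ext_degree \<phi>\<close> suffices, since
      \<open>k < 2 ^ k\<close>.\<close>
    then obtain L where "DF.dim L = 2 ^ ext_degree \<phi>" by blast
    then show False
      using DF.dim_subset[of L UNIV] less_exp[of "ext_degree \<phi>"] by (metis ext_degree_def leD top_greatest)
  qed
  then obtain m where m: "ext_degree \<phi> = 2 ^ m" by blast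
  then have "m \<ge> 1"
    using d by (cases m) auto
  have "CHAR('f) = 2"
  proof (rule CHAR_eq_posI)
    show "of_nat 2 = (0::'f)"
      using conj_id_if_trace_zero(3)[OF T] by simp
    show "of_nat x \<noteq> (0::'f)" if "0 < x" "x < 2" for x
    proof -
      have "x = 1" using that by linarith
      then show ?thesis by simp
    qed
  qed simp
  then show ?thesis
    using m \<open>m \<ge> 1\<close> comm sq
    by (auto simp: quadratic_type_iv_def commutative_ring_def power2_eq_square)
qed

theorem quadratic_type_if_conjugation:
  assumes "finite_dimensional_vector_space (alg_scale \<phi>) E"
  shows "quadratic_type \<phi>"
proof (cases "ext_degree \<phi> = 1")
  case True
  then show ?thesis
    by (simp add: quadratic_type_def quadratic_type_i_def)
next
  case d: False
  show ?thesis
  proof (cases "\<forall>z. trace z = 0")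
    case True
    then show ?thesis
      using quadratic_type_iv_if_trace_zero d assms by (auto simp: quadratic_type_def)
  next
    case False
    interpret DF: finite_dimensional_vector_space "alg_scale \<phi>" E by fact
    have "range \<phi> \<noteq> UNIV"
    proof
      assume "range \<phi> = UNIV"
      moreover have "range \<phi> = DF.span {1}"
        by (simp add: DF.span_singleton alg_scale_def)
      ultimately have "DF.dim UNIV = DF.dim {1}"
        by (metis DF.dim_span)
      then show False
        using d by (simp add: ext_degree_def)
    qed
    then obtain u where "u \<notin> range \<phi>" "u \<noteq> \<tau> u"
      using False exists_nonfixed by (metis UNIV_eq_I)
    then show ?thesis
      using quadratic_type_ii_if_commutative[OF _ d assms] quaternion_if_noncommutative[OF _ assms]
      unfolding quadratic_type_def by metis
  qed
qed

end

section \<open>Associated pairs and sesquilinear forms\<close>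

lemma (in central_subfield) range_eq_UNIV_iff:
  assumes "finite_dimensional_vector_space (alg_scale \<phi>) E"
  shows "range \<phi> = UNIV \<longleftrightarrow> ext_degree \<phi> = 1"
proof -
  interpret DF: finite_dimensional_vector_space "alg_scale \<phi>" E by fact
  have span: "range \<phi> = DF.span {1}"
    by (simp add: DF.span_singleton alg_scale_def)
  then have one: "DF.dim (range \<phi>) = 1"
    by simp
  show ?thesis
  proof
    assume "ext_degree \<phi> = 1"
    then show "range \<phi> = UNIV"
      using DF.subspace_dim_equal[of "range \<phi>" UNIV] one span by (simp add: ext_degree_def)
  qed (use one in \<open>simp add: ext_degree_def\<close>)
qed

text \<open>Sending \<open>c\<close> to the form \<open>e (c * x)\<close> in \<open>x\<close> is
  injective, because a nonzero \<open>c\<close> is invertible and \<open>e\<close> is nonzero. By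
  equality of finite dimensions it reaches every linear form.\<close>

lemma (in central_subfield) linear_form_representation:
  assumes "finite_dimensional_vector_space (alg_scale \<phi>) E"
    and e: "Vector_Spaces.linear (alg_scale \<phi>) (*) e" "e z \<noteq> 0"
    and g: "Vector_Spaces.linear (alg_scale \<phi>) (*) g"
  obtains c where "\<And>x. g x = e (c * x)"
proof -
  interpret DF: finite_dimensional_vector_space "alg_scale \<phi>" E by fact
  interpret e: Vector_Spaces.linear "alg_scale \<phi>" "(*)" e by fact
  interpret g: Vector_Spaces.linear "alg_scale \<phi>" "(*)" g by fact
  have e_scale: "e (\<phi> a * x) = a * e x" for a x
    using e.scale[of a x] by (simp add: alg_scale_def)
  \<comment> \<open>A form is recorded as the vector whose coordinates in \<open>E\<close> are its
    values on \<open>E\<close>. This makes the map an endomorphism, for which injective implies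
    surjective.\<close>
  define \<Phi> where "\<Phi> c = (\<Sum>v\<in>E. alg_scale \<phi> (e (c * v)) v)" for c
  have lin: "Vector_Spaces.linear (alg_scale \<phi>) (alg_scale \<phi>) \<Phi>"
    by unfold_locales
      (simp_all add: \<Phi>_def distrib_right e.add DF.scale_left_distrib sum.distrib
        alg_scale_def mult.assoc e_scale hom_mult hom_add sum_distrib_left)
  interpret lin: Vector_Spaces.linear "alg_scale \<phi>" "alg_scale \<phi>" \<Phi> by fact
  have lin_left: "Vector_Spaces.linear (alg_scale \<phi>) (*) (\<lambda>x. e (c * x))" for c
    by unfold_locales
      (simp_all add: e.add alg_scale_def hom_left_commute e_scale algebra_simps)
  have agree: "e (c * x) = h x"
    if "\<And>v. v \<in> E \<Longrightarrow> e (c * v) = h v" and h: "Vector_Spaces.linear (alg_scale \<phi>) (*) h" for c x h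
  proof -
    interpret P: vector_space_pair "alg_scale \<phi>" "(*) :: 'f \<Rightarrow> 'f \<Rightarrow> 'f"
      by unfold_locales
    show ?thesis
      using P.linear_eq_on[OF lin_left[of c] h, of x E] that(1) by (simp add: DF.span_Basis)
  qed
  have zero: "Vector_Spaces.linear (alg_scale \<phi>) (*) (\<lambda>x. 0 :: 'f)"
    by unfold_locales simp_all
  have "inj \<Phi>"
    unfolding lin.inj_iff_eq_0
  proof (intro allI impI)
    fix c assume "\<Phi> c = 0"
    then have "\<And>v. v \<in> E \<Longrightarrow> e (c * v) = 0"
      using DF.independentD[OF DF.independent_Basis DF.finite_Basis subset_refl]
      by (simp add: \<Phi>_def)
    then have "e (c * (inverse c * z)) = 0"
      using agree[OF _ zero] by simp
    then show "c = 0"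
      using e(2) by (metis mult.assoc right_inverse mult_1)
  qed
  then have "surj \<Phi>"
    using DF.linear_inj_imp_surj[OF lin] by blast
  then obtain c where "\<Phi> c = (\<Sum>v\<in>E. alg_scale \<phi> (g v) v)"
    by (metis surjD)
  then have "(\<Sum>v\<in>E. alg_scale \<phi> (e (c * v) - g v) v) = 0"
    by (simp add: \<Phi>_def DF.scale_left_diff_distrib sum_subtractf)
  then have "\<And>v. v \<in> E \<Longrightarrow> e (c * v) - g v = 0"
    using DF.independentD[OF DF.independent_Basis DF.finite_Basis subset_refl, of "\<lambda>v. e (c * v) - g v"]
    by blast
  then have "g x = e (c * x)" for x
    using agree[OF _ g] by simp
  then show ?thesis
    using that by blast
qed

section \<open>Comparison of associated pairs with the conjugation\<close>

context quadratic_conjugation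
begin

text \<open>\<open>g\<close> fixes the coefficients of the quadratic equation of a nonscalar
  \<open>u\<close>, so \<open>g u\<close> is one of its roots \<open>u\<close> and
  \<open>\<tau> u\<close>. In degree 2, \<open>F[u]\<close> is everything, so this value determines
  \<open>g\<close>.\<close>

lemma automorphism_cases:
  assumes comm: "\<And>x y :: 'd. x * y = y * x" and d: "ext_degree \<phi> = 2"
    and fin: "finite_dimensional_vector_space (alg_scale \<phi>) E"
    and g: "g \<in> alg_automorphisms \<phi>"
  shows "g = id \<or> g = \<tau>"
proof -
  interpret DF: finite_dimensional_vector_space "alg_scale \<phi>" E by fact
  have add: "g (x + y) = g x + g y" and mult: "g (x * y) = g x * g y" and hom_fix: "g (\<phi> a) = \<phi> a" for x y a
    using g by (auto simp: alg_automorphisms_def)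
  have "range \<phi> \<noteq> UNIV"
    using range_eq_UNIV_iff[OF fin] d by simp
  then obtain u where u: "u \<notin> range \<phi>" by blast
  have "DF.dim (plane u) = 2 * DF.dim (range \<phi>)"
    unfolding plane_def
  proof (rule dim_double[OF fin])
    show "DF.subspace (range \<phi>)"
      using zero_in_range by (auto simp: DF.subspace_def alg_scale_def intro: range_add range_mult)
    show "u \<noteq> 0"
      using u zero_in_range by blast
    show "x = 0" if "x \<in> range \<phi>" "x * u \<in> range \<phi>" for x
      using that u range_mult_cancel by blast
  qed
  moreover have "range \<phi> = DF.span {1}"
    by (simp add: DF.span_singleton alg_scale_def)
  ultimately have "DF.dim (plane u) = DF.dim UNIV"
    using d by (simp add: ext_degree_def)
  then have all: "plane u = UNIV"
    using DF.subspace_dim_equal[OF subspace_plane, of UNIV u] by (metis DF.subspace_UNIV order_refl top_greatest)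
  have "g u * g u = \<phi> (trace u) * g u - \<phi> (norm u)"
  proof -
    have "u * u + \<phi> (norm u) = \<phi> (trace u) * u"
      using square_eq[of u] by simp
    then have "g (u * u + \<phi> (norm u)) = g (\<phi> (trace u) * u)"
      by simp
    then show ?thesis
      by (simp add: add mult hom_fix eq_diff_eq)
  qed
  then have "(g u - u) * (g u - \<tau> u) = 0"
    by (simp add: algebra_simps conj_eq[of u] square_eq[of u] comm[of u "g u"]
        hom_commute[of u] hom_commute[of "g u"])
  then consider "g u = u" | "g u = \<tau> u"
    by auto
  then show ?thesis
  proof cases
    case 1
    have "g x = x" for x
    proof -
      obtain a b where "x = \<phi> a + \<phi> b * u"
        using all unfolding plane_def by blast
      then show ?thesis
        by (simp add: add mult hom_fix 1)
    qed
    then show ?thesis by auto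
  next
    case 2
    have "g x = \<tau> x" for x
    proof -
      obtain a b where "x = \<phi> a + \<phi> b * u"
        using all unfolding plane_def by blast
      then show ?thesis
        by (simp add: add mult hom_fix 2 conj_add conj_scale)
    qed
    then show ?thesis by auto
  qed
qed

text \<open>Types (ii) and (iii) follow from \<open>automorphism_cases\<close> and
  \<open>conj_unique\<close>. In type (iv), \<open>x + x = 0\<close> and \<open>x * x\<close> is
  scalar, so \<open>conj_eqI\<close> applies with \<open>y = x\<close>.\<close>

lemma standard_involution_unique:
  assumes "standard_involution \<phi> \<sigma>" and fin: "finite_dimensional_vector_space (alg_scale \<phi>) E"
  shows "\<sigma> = \<tau>"
proof -
  consider "quadratic_type_i \<phi>" "\<sigma> = id" | "quadratic_type_iv \<phi>" "\<sigma> = id"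
    | "quadratic_type_ii \<phi>" "\<sigma> \<in> alg_automorphisms \<phi>" "\<sigma> \<noteq> id"
    | "quaternionic_conjugation \<phi> \<sigma>"
    using assms(1) unfolding standard_involution_def by blast
  then show ?thesis
  proof cases
    case 1
    then have "range \<phi> = UNIV"
      using range_eq_UNIV_iff[OF fin] by (simp add: quadratic_type_i_def)
    then have "\<tau> x = x" for x
      by (metis UNIV_I conj_range)
    then show ?thesis
      using 1 by auto
  next
    case 2
    then have "of_nat 2 = (0::'f)" and sq: "x * x \<in> range \<phi>" for x
      using of_nat_CHAR[where 'a = 'f] by (auto simp: quadratic_type_iv_def power2_eq_square)
    then have "\<phi> 2 = 0"
      by simp
    moreover have "x + x = \<phi> 2 * x" for x
      by (metis hom_add hom_one one_add_one distrib_right mult_1)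
    ultimately have "x + x = 0" for x :: 'd
      by simp
    then have "x + x \<in> range \<phi>" for x
      by (simp only: zero_in_range)
    then have "x = \<tau> x" for x
      using conj_eqI[of x x] conj_range sq by metis
    then show ?thesis
      using 2 by auto
  next
    case 3
    then show ?thesis
      using automorphism_cases[OF _ _ fin] by (auto simp: quadratic_type_ii_def commutative_ring_def)
  next
    case 4
    then have add: "\<sigma> (x + y) = \<sigma> x + \<sigma> y" and hom_fix: "\<sigma> (\<phi> a) = \<phi> a"
      and mult: "\<sigma> (x * y) = \<sigma> y * \<sigma> x" and norm: "x * \<sigma> x \<in> range \<phi>" for x y a
      unfolding quaternionic_conjugation_def by blast+
    have "quadratic_conjugation \<phi> \<sigma>"
    proof
      show "\<sigma> (\<phi> a * x) = \<phi> a * \<sigma> x" for a x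
        by (simp add: mult hom_fix hom_commute)
      show "\<sigma> 1 = 1"
        using hom_fix[of 1] by (simp add: hom_one)
    qed (fact add norm)+
    then show ?thesis
      by (rule conj_unique)
  qed
qed

text \<open>Nonvanishing lets \<open>e\<close> represent all linear forms; symmetry later carries
  \<open>\<tau> \<alpha>\<close> from the right of \<open>B x y\<close> to its left.\<close>

lemma associated_form_properties:
  assumes pair: "associated_pair \<phi> \<sigma> e" and fin: "finite_dimensional_vector_space (alg_scale \<phi>) E"
  shows "\<exists>x. e x \<noteq> 0" and "e (x * y) = e (y * x)"
proof -
  have \<sigma>: "\<sigma> = \<tau>"
    using pair standard_involution_unique fin by (auto simp: associated_pair_def)
  consider (i) "quadratic_type_i \<phi>" "galois_trace \<phi> e" | (ii) "quadratic_type_ii \<phi>" "galois_trace \<phi> e"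
    | (iii) "quadratic_type_iii \<phi>" "\<And>x. \<phi> (e x) = x + \<tau> x"
    | (iv) "quadratic_type_iv \<phi>" "\<exists>x. e x \<noteq> 0"
    using pair unfolding associated_pair_def \<sigma> by blast
  then have "(\<exists>x. e x \<noteq> 0) \<and> (\<forall>x y. e (x * y) = e (y * x))"
  proof cases
    case i
    then have all: "range \<phi> = UNIV"
      using range_eq_UNIV_iff[OF fin] by (simp add: quadratic_type_i_def)
    then have comm: "x * y = y * x" for x y :: 'd
      by (metis UNIV_I range_commute)
    have "g = id" if "g \<in> alg_automorphisms \<phi>" for g
    proof
      fix x
      obtain a where "x = \<phi> a"
        using all by blast
      then show "g x = id x"
        using that by (simp add: alg_automorphisms_def)
    qed
    moreover have "id \<in> alg_automorphisms \<phi>"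
      by (simp add: alg_automorphisms_def)
    ultimately have "alg_automorphisms \<phi> = {id}"
      by blast
    then have "\<phi> (e 1) = 1"
      using i(2) by (simp add: galois_trace_def)
    then have "e 1 \<noteq> 0"
      by auto
    then show ?thesis
      using comm by metis
  next
    case ii
    then have comm: "x * y = y * x" for x y :: 'd
      by (simp add: quadratic_type_ii_def commutative_ring_def)
    have id: "id \<in> alg_automorphisms \<phi>"
      by (simp add: alg_automorphisms_def)
    have sub: "alg_automorphisms \<phi> \<subseteq> {id, \<tau>}"
      using automorphism_cases[OF comm _ fin] ii(1) by (auto simp: quadratic_type_ii_def)
    \<comment> \<open>The Galois trace is \<open>x\<close> itself if the group is
      \<open>{id}\<close>; for \<open>{id, \<tau>}\<close> it is \<open>trace x\<close>, which
      cannot vanish everywhere when \<open>\<tau>\<close> is not the identity.\<close>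
    have "\<exists>x. e x \<noteq> 0"
    proof (cases "alg_automorphisms \<phi> = {id}")
      case True
      then have "\<phi> (e 1) = 1"
        using ii(2) by (simp add: galois_trace_def)
      then have "e 1 \<noteq> 0"
        by auto
      then show ?thesis by blast
    next
      case False
      then have eq: "alg_automorphisms \<phi> = {id, \<tau>}" and ne: "\<tau> \<noteq> id"
        using id sub by blast+
      have "\<phi> (e x) = \<phi> (trace x)" for x
        using ii(2) ne by (simp add: galois_trace_def eq hom_trace)
      then have "e x = trace x" for x
        by simp
      then show ?thesis
        using conj_id_if_trace_zero(1) ne by metis
    qed
    then show ?thesis
      using comm by metis
  next
    case iii
    then have tr: "e = trace"
      by (metis ext hom_eq_iff hom_trace)
    have "\<exists>x. trace x \<noteq> 0"
    proof (rule ccontr)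
      assume "\<nexists>x. trace x \<noteq> 0"
      then have comm: "x * y = y * x" for x y :: 'd
        using trace_zero_imp_commute by blast
      have "z \<in> center" for z :: 'd
        unfolding center_def mem_Collect_eq using comm by blast
      then have "range \<phi> = UNIV"
        using iii(1) by (auto simp: quadratic_type_iii_def quaternion_algebra_def)
      then show False
        using range_eq_UNIV_iff[OF fin] iii(1) by (simp add: quadratic_type_iii_def)
    qed
    then show ?thesis
      using tr trace_mult_commute by simp
  next
    case iv
    then have "x * y = y * x" for x y :: 'd
      by (simp add: quadratic_type_iv_def commutative_ring_def)
    then show ?thesis
      using iv(2) by metis
  qed
  then show "\<exists>x. e x \<noteq> 0" "e (x * y) = e (y * x)"
    by auto
qed

text \<open>\<open>B x y\<close> is the element representing, through \<open>e\<close>, the form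
  that sends \<open>\<beta>\<close> to \<open>b x (sV y \<beta>)\<close>. Right linearity and
  uniqueness follow from this choice; semilinearity in \<open>x\<close> and nondegeneracy come from
  \<open>norm\<close>.\<close>

theorem sesquilinear_representation:
  assumes fin: "finite_dimensional_vector_space (alg_scale \<phi>) E"
    and "right_vector_space sU" "right_vector_space sV"
    and b: "bilinear_form \<phi> sU sV b"
    and norm: "\<And>z y \<alpha>. b (sU z \<alpha>) (sV y \<alpha>) = norm \<alpha> * b z y"
    and nondeg: "right_nondegenerate b"
    and pair: "associated_pair \<phi> \<sigma> e"
  shows "\<exists>!B. sesquilinear sU sV \<sigma> B \<and> right_nondegenerate B \<and> b = (\<lambda>x y. e (B x y))"
proof -
  interpret U: right_vector_space sU by fact
  interpret V: right_vector_space sV by fact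
  have \<sigma>: "\<sigma> = \<tau>"
    using pair standard_involution_unique fin by (auto simp: associated_pair_def)
  have lin_e: "Vector_Spaces.linear (alg_scale \<phi>) (*) e"
    using pair by (simp add: associated_pair_def)
  interpret e: Vector_Spaces.linear "alg_scale \<phi>" "(*)" e by fact
  have e_scale: "e (\<phi> a * x) = a * e x" for a x
    using e.scale[of a x] by (simp add: alg_scale_def)
  obtain z where z: "e z \<noteq> 0"
    using associated_form_properties(1)[OF pair fin] by blast
  note sym = associated_form_properties(2)[OF pair fin]
  have eqI: "c = c'" if "\<And>x. e (c * x) = e (c' * x)" for c c'
  proof (rule ccontr)
    assume "c \<noteq> c'"
    then have "(c - c') * (inverse (c - c') * z) = z"
      by (simp flip: mult.assoc)
    moreover have "e ((c - c') * x) = 0" for x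
      using that[of x] by (simp add: left_diff_distrib e.diff)
    ultimately show False
      using z by metis
  qed
  have lin1: "Vector_Spaces.linear (restrict_scale \<phi> sU) (*) (\<lambda>x. b x y)"
    and lin2: "Vector_Spaces.linear (restrict_scale \<phi> sV) (*) (b x)" for x y
    using b by (auto simp: bilinear_form_def)
  have add1: "b (x + x') y = b x y + b x' y" for x x' y
    using lin1[of y] by (simp add: Vector_Spaces.linear_iff)
  have add2: "b x (y + y') = b x y + b x y'" and scale2: "b x (sV y (\<phi> a)) = a * b x y" for x y y' a
    using lin2[of x] by (simp_all add: Vector_Spaces.linear_iff restrict_scale_def)
  have "\<exists>c. \<forall>\<beta>. b x (sV y \<beta>) = e (c * \<beta>)" for x y
  proof -
    have "b x (sV y (\<phi> a * \<beta>)) = a * b x (sV y \<beta>)" for a \<beta>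
      using scale2[of x "sV y \<beta>" a] by (simp add: V.scale_mult[symmetric] hom_commute)
    then have "Vector_Spaces.linear (alg_scale \<phi>) (*) (\<lambda>\<beta>. b x (sV y \<beta>))"
      by unfold_locales (simp_all add: V.scale_add_right add2 alg_scale_def distrib_left mult.assoc
          distrib_right hom_add hom_mult hom_one)
    then show ?thesis
      using linear_form_representation[OF fin lin_e z] by metis
  qed
  then obtain B where B: "b x (sV y \<beta>) = e (B x y * \<beta>)" for x y \<beta>
    by metis
  have bB: "b x y = e (B x y)" for x y
    using B[of x y 1] by (simp add: V.scale_one)
  have B_scale2: "B x (sV y \<alpha>) = B x y * \<alpha>" for x y \<alpha>
    by (rule eqI) (simp add: mult.assoc V.scale_mult[symmetric] flip: B)
  have B_add2: "B x (y + y') = B x y + B x y'" for x y y'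
    by (rule eqI) (simp add: distrib_right e.add V.scale_add_left add2 flip: B)
  have B_add1: "B (x + x') y = B x y + B x' y" for x x' y
    by (rule eqI) (simp add: distrib_right e.add add1 flip: B)
  have zero1: "b 0 y = 0" for y
    using add1[of 0 0 y] by (metis add_cancel_right_right)
  have U0: "sU x 0 = 0" for x
    using U.scale_add_right[of x 0 0] by simp
  have B_scale1: "B (sU x \<alpha>) y = \<tau> \<alpha> * B x y" for x y \<alpha>
  proof (cases "\<alpha> = 0")
    case True
    have "e (B 0 y * \<beta>) = e (0 * \<beta>)" for \<beta>
      by (simp add: zero1 e.zero flip: B)
    then show ?thesis
      using eqI by (simp add: True U0)
  next
    case False
    show ?thesis
    proof (rule eqI)
      fix \<beta>
      \<comment> \<open>The factor \<open>\<alpha>\<close> is split off from \<open>\<beta>\<close>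
        so that both arguments of \<open>b\<close> are scaled by \<open>\<alpha>\<close> and
        \<open>norm\<close> applies.\<close>
      have "e (B (sU x \<alpha>) y * \<beta>) = b (sU x \<alpha>) (sV (sV y (\<beta> * inverse \<alpha>)) \<alpha>)"
        using False by (simp add: mult.assoc V.scale_mult[symmetric] flip: B)
      also have "\<dots> = e (\<phi> (norm \<alpha>) * (B x y * (\<beta> * inverse \<alpha>)))"
        by (simp add: norm e_scale flip: B)
      also have "\<dots> = e ((B x y * \<beta>) * (inverse \<alpha> * \<phi> (norm \<alpha>)))"
        by (metis hom_commute mult.assoc)
      also have "inverse \<alpha> * \<phi> (norm \<alpha>) = \<tau> \<alpha>"
        using False by (simp add: hom_norm) (simp flip: mult.assoc)
      also have "e ((B x y * \<beta>) * \<tau> \<alpha>) = e (\<tau> \<alpha> * B x y * \<beta>)"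
        using sym[of "B x y * \<beta>" "\<tau> \<alpha>"] by (simp add: mult.assoc)
      finally show "e (B (sU x \<alpha>) y * \<beta>) = e (\<tau> \<alpha> * B x y * \<beta>)" .
    qed
  qed
  \<comment> \<open>The radical of \<open>b\<close> is stable under scaling: writing
    \<open>x\<close> as a multiple by \<open>\<beta>\<close> gives \<open>b x (sV y \<beta>) = norm
    \<beta> * b (sU x (inverse \<beta>)) y\<close>.\<close>
  have "(\<forall>x. B x y = 0) \<longleftrightarrow> (\<forall>x. b x y = 0)" for y
  proof
    assume 0: "\<forall>x. b x y = 0"
    show "\<forall>x. B x y = 0"
    proof
      fix x
      have "e (B x y * \<beta>) = e (0 * \<beta>)" for \<beta>
      proof (cases "\<beta> = 0")
        case False
        have x: "sU (sU x (inverse \<beta>)) \<beta> = x"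
          using False by (simp add: U.scale_one flip: U.scale_mult)
        have "e (B x y * \<beta>) = b (sU (sU x (inverse \<beta>)) \<beta>) (sV y \<beta>)"
          by (simp add: B x)
        also have "\<dots> = 0"
          by (simp add: norm 0)
        finally show ?thesis
          by (simp add: e.zero)
      qed simp
      then show "B x y = 0"
        by (rule eqI)
    qed
  qed (simp add: bB e.zero)
  then have "right_nondegenerate B"
    using nondeg by (simp add: right_nondegenerate_def)
  moreover have "sesquilinear sU sV \<sigma> B"
    by (simp add: sesquilinear_def B_add1 B_add2 B_scale1 B_scale2 \<sigma>)
  moreover have "B' = B" if B': "sesquilinear sU sV \<sigma> B'" "b = (\<lambda>x y. e (B' x y))" for B'
  proof (intro ext eqI)
    fix x y \<beta>
    have lin: "B' x (sV y \<alpha> + y') = B' x y * \<alpha> + B' x y'" for \<alpha> y y'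
      using B'(1) by (simp add: sesquilinear_def)
    have "B' x 0 = 0"
      using lin[of 0 1 0] by (simp add: V.scale_one)
    then have "B' x (sV y \<beta>) = B' x y * \<beta>"
      using lin[of y \<beta> 0] by simp
    then show "e (B' x y * \<beta>) = e (B x y * \<beta>)"
      using B'(2) B[of x y \<beta>] by metis
  qed
  ultimately show ?thesis
    using bB by blast
qed

end

section \<open>Dimensions over the central subfield\<close>

text \<open>\<open>dim\<close> is 0 by default on infinite-dimensional sets, so
  \<open>dim S \<le> k\<close> alone would say too little about spaces of operators. This bound
  asserts finite dimension as well.\<close>

definition (in vector_space) spanned_by_at_most :: "'b set \<Rightarrow> nat \<Rightarrow> bool" where
  "spanned_by_at_most S k \<longleftrightarrow> (\<exists>B. finite B \<and> card B \<le> k \<and> S \<subseteq> span B)"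

lemma (in vector_space) spanned_by_at_most_mono:
  "spanned_by_at_most S k \<Longrightarrow> S' \<subseteq> S \<Longrightarrow> k \<le> k' \<Longrightarrow> spanned_by_at_most S' k'"
  unfolding spanned_by_at_most_def by (meson order_trans)

lemma (in vector_space) dim_le_if_spanned: "spanned_by_at_most S k \<Longrightarrow> dim S \<le> k"
  unfolding spanned_by_at_most_def using dim_le_card order_trans by blast

lemma (in finite_dimensional_vector_space) spanned_if_dim_le: "dim S \<le> k \<Longrightarrow> spanned_by_at_most S k"
  unfolding spanned_by_at_most_def by (metis basis_exists finiteI_independent)

lemma (in vector_space_pair) spanned_by_at_most_rank_nullity:
  assumes lin: "Vector_Spaces.linear s1 s2 f" and S: "vs1.subspace S"
    and img: "vs2.spanned_by_at_most (f ` S) k"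
    and ker: "vs1.spanned_by_at_most {x \<in> S. f x = 0} l"
  shows "vs1.spanned_by_at_most S (k + l)"
proof -
  interpret f: Vector_Spaces.linear s1 s2 f by fact
  obtain A where A: "finite A" "card A \<le> k" "f ` S \<subseteq> vs2.span A"
    using img unfolding vs2.spanned_by_at_most_def by blast
  obtain C where C: "finite C" "card C \<le> l" "{x \<in> S. f x = 0} \<subseteq> vs1.span C"
    using ker unfolding vs1.spanned_by_at_most_def by blast
  \<comment> \<open>\<open>A\<close> may lie outside the image. An independent set inside the image
    can be lifted to \<open>S\<close>, and the exchange lemma bounds its size by that of
    \<open>A\<close>.\<close>
  obtain B where B: "B \<subseteq> f ` S" "vs2.independent B" "f ` S \<subseteq> vs2.span B"
    by (rule vs2.maximal_independent_subset[of "f ` S"])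
  then have "finite B \<and> card B \<le> card A"
    using B(1) A(3) by (intro vs2.independent_span_bound[OF A(1) B(2)]) (rule order_trans)
  then have fin: "finite B" and card: "card B \<le> k"
    using A(2) by auto
  define B' where "B' = inv_into S f ` B"
  have B': "B' \<subseteq> S" "f ` B' = B"
    using B(1) by (auto simp: B'_def inv_into_into image_image f_inv_into_f subset_iff image_iff)
  have "x \<in> vs1.span (B' \<union> C)" if x: "x \<in> S" for x
  proof -
    have "f x \<in> f ` vs1.span B'"
      using B(3) x f.span_image[of B'] B'(2) by auto
    then obtain y where y: "y \<in> vs1.span B'" "f x = f y"
      by blast
    then have "y \<in> S"
      using vs1.span_minimal[OF B'(1) S] by blast
    then have "x - y \<in> {x \<in> S. f x = 0}"
      using x y(2) vs1.subspace_diff[OF S] by (simp add: f.diff)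
    then have "x - y \<in> vs1.span C"
      using C(3) by blast
    then have "(x - y) + y \<in> vs1.span (B' \<union> C)"
      using y(1) vs1.span_mono[of B' "B' \<union> C"] vs1.span_mono[of C "B' \<union> C"]
      by (intro vs1.span_add) auto
    then show ?thesis by simp
  qed
  moreover have "card (B' \<union> C) \<le> k + l"
    using card_Un_le[of B' C] card_image_le[OF fin, of "inv_into S f"] card C(2)
    unfolding B'_def by linarith
  moreover have "finite (B' \<union> C)"
    using fin C(1) by (simp add: B'_def)
  ultimately show ?thesis
    unfolding vs1.spanned_by_at_most_def by blast
qed

section \<open>Right vector spaces over the division ring\<close>

context right_vector_space
begin

lemma scale_zero_right [simp]: "s x 0 = 0"
  using scale_add_right[of x 0 0] by simp

lemma scale_zero_left [simp]: "s 0 a = 0"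
  using scale_add_left[of 0 0 a] by simp

lemma scale_minus_right: "s x (- a) = - s x a"
  using scale_add_right[of x a "- a"] by (simp add: eq_neg_iff_add_eq_0 add.commute)

lemma scale_scale_inverse: "a \<noteq> 0 \<Longrightarrow> s (s x a) (inverse a) = x" "a \<noteq> 0 \<Longrightarrow> s (s x (inverse a)) a = x"
  by (simp_all add: scale_one flip: scale_mult)

lemma scale_sum_left: "s (sum f A) a = (\<Sum>x\<in>A. s (f x) a)"
  by (induction A rule: infinite_finite_induct) (simp_all add: scale_add_left)

end

text \<open>Even right subspaces are measured over the subfield, since the sets \<open>S x\<close>
  are stable only under it; \<open>deg\<close> is the conversion factor.\<close>

locale extended_scalars = central_subfield \<phi> + right_vector_space s
  for \<phi> :: "'f::field \<Rightarrow> 'd::division_ring" and s :: "'v::ab_group_add \<Rightarrow> 'd \<Rightarrow> 'v" +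
  fixes ED :: "'d set" and EV :: "'v set"
  assumes fin_D: "finite_dimensional_vector_space (alg_scale \<phi>) ED"
    and fin_V: "finite_dimensional_vector_space (restrict_scale \<phi> s) EV"
begin

sublocale DF: finite_dimensional_vector_space "alg_scale \<phi>" ED
  by (rule fin_D)

sublocale VF: finite_dimensional_vector_space "restrict_scale \<phi> s" EV
  by (rule fin_V)

abbreviation deg :: nat where "deg \<equiv> ext_degree \<phi>"

lemma deg_pos: "deg > 0"
proof (rule ccontr)
  assume "\<not> deg > 0"
  then have "DF.dim UNIV = 0"
    by (simp add: ext_degree_def)
  then have "(1::'d) \<in> {0}"
    unfolding DF.dim_eq_0 by blast
  then show False by simp
qed

lemma right_subspace_imp_subspace: "right_subspace s W \<Longrightarrow> VF.subspace W"
  by (auto simp: right_subspace_def VF.subspace_def restrict_scale_def)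

lemma right_subspace_add_line:
  assumes W: "right_subspace s W"
  shows "right_subspace s {w + s v c |w c. w \<in> W}"
  unfolding right_subspace_def
proof (intro conjI ballI allI)
  have "0 \<in> W"
    using W by (simp add: right_subspace_def)
  then have "0 + s v 0 \<in> {w + s v c |w c. w \<in> W}"
    by blast
  then show "0 \<in> {w + s v c |w c. w \<in> W}"
    by simp
  fix x assume "x \<in> {w + s v c |w c. w \<in> W}"
  then obtain w c where x: "x = w + s v c" "w \<in> W" by blast
  show "s x a \<in> {w + s v c |w c. w \<in> W}" for a
  proof -
    have "s x a = s w a + s v (c * a)" "s w a \<in> W"
      using x W by (simp_all add: scale_add_left scale_mult right_subspace_def)
    then show ?thesis by blast
  qed
  fix y assume "y \<in> {w + s v c |w c. w \<in> W}"
  then obtain w' c' where y: "y = w' + s v c'" "w' \<in> W" by blast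
  have "x + y = (w + w') + s v (c + c')"
    using x y by (simp add: scale_add_right algebra_simps)
  moreover have "w + w' \<in> W"
    using x y W by (simp add: right_subspace_def)
  ultimately show "x + y \<in> {w + s v c |w c. w \<in> W}"
    by blast
qed

lemma dim_add_line:
  assumes W: "right_subspace s W" and v: "v \<notin> W"
  shows "VF.dim {w + s v c |w c. w \<in> W} = VF.dim W + deg"
proof -
  interpret P: finite_dimensional_vector_space_pair_1 "alg_scale \<phi>" ED "restrict_scale \<phi> s"
    by unfold_locales
  have lin: "Vector_Spaces.linear (alg_scale \<phi>) (restrict_scale \<phi> s) (s v)"
    by unfold_locales
      (simp_all add: alg_scale_def restrict_scale_def scale_add_right flip: hom_commute scale_mult)
  interpret lin: Vector_Spaces.linear "alg_scale \<phi>" "restrict_scale \<phi> s" "s v" by fact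
  have notin: "c = 0" if "s v c \<in> W" for c
  proof (rule ccontr)
    assume "c \<noteq> 0"
    then have "s (s v c) (inverse c) = v"
      by (rule scale_scale_inverse)
    then show False
      using W that v unfolding right_subspace_def by metis
  qed
  have "0 \<in> W"
    using W by (simp add: right_subspace_def)
  then have "inj (s v)"
    unfolding lin.inj_iff_eq_0 using notin by metis
  then have "VF.dim (range (s v)) = DF.dim UNIV"
    by (intro P.dim_image_eq[OF lin]) (simp add: DF.span_UNIV)
  moreover have "W \<inter> range (s v) \<subseteq> {0}"
    using notin by (auto dest!: notin)
  then have "VF.dim (W \<inter> range (s v)) = 0"
    unfolding VF.dim_eq_0 .
  moreover have "{x + y |x y. x \<in> W \<and> y \<in> range (s v)} = {w + s v c |w c. w \<in> W}"
    by blast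
  moreover have "VF.dim {x + y |x y. x \<in> W \<and> y \<in> range (s v)} + VF.dim (W \<inter> range (s v))
      = VF.dim W + VF.dim (range (s v))"
    by (intro VF.dim_sums_Int right_subspace_imp_subspace[OF W] lin.subspace_image DF.subspace_UNIV)
  ultimately show ?thesis
    unfolding ext_degree_def by (simp only: add_0_right)
qed

text \<open>Adjoining to \<open>W'\<close> the line of a vector of \<open>W\<close> outside it adds
  exactly \<open>deg\<close>; this is repeated until \<open>W\<close> is reached.\<close>

lemma right_subspace_codim:
  assumes "right_subspace s W'" "right_subspace s W" "W' \<subseteq> W"
  shows "\<exists>k. VF.dim W = VF.dim W' + k * deg"
  using assms
proof (induction "VF.dim W - VF.dim W'" arbitrary: W' rule: less_induct)
  case less
  show ?case
  proof (cases "W' = W")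
    case True
    then have "VF.dim W = VF.dim W' + 0 * deg" by simp
    then show ?thesis by blast
  next
    case False
    then obtain v where v: "v \<in> W" "v \<notin> W'"
      using less.prems by blast
    define W1 where "W1 = {w + s v c |w c. w \<in> W'}"
    have W1: "right_subspace s W1" "VF.dim W1 = VF.dim W' + deg"
      using right_subspace_add_line dim_add_line less.prems(1) v(2) by (auto simp: W1_def)
    have "W1 \<subseteq> W"
      using less.prems v(1) by (auto simp: W1_def right_subspace_def)
    moreover from this have "VF.dim W1 \<le> VF.dim W"
      by (rule VF.dim_subset)
    then have "VF.dim W - VF.dim W1 < VF.dim W - VF.dim W'"
      using W1(2) deg_pos by linarith
    ultimately obtain k where "VF.dim W = VF.dim W1 + k * deg"
      using less.hyps W1(1) less.prems(2) by blast
    then have "VF.dim W = VF.dim W' + Suc k * deg"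
      using W1(2) by simp
    then show ?thesis by blast
  qed
qed

lemma right_subspace_zero: "right_subspace s {0}"
  by (simp add: right_subspace_def)

lemma right_subspace_UNIV: "right_subspace s UNIV"
  by (simp add: right_subspace_def)

lemma right_subspace_dim:
  assumes W: "right_subspace s W"
  obtains k where "VF.dim W = k * deg"
proof -
  have "{0} \<subseteq> W"
    using W by (simp add: right_subspace_def)
  then obtain k where "VF.dim W = VF.dim {0} + k * deg"
    using right_subspace_codim[OF right_subspace_zero W] by blast
  then have "VF.dim W = k * deg"
    by simp
  then show ?thesis
    by (rule that)
qed

lemma right_subspace_span: "right_subspace s (right_span s B)"
  unfolding right_subspace_def
proof (intro conjI ballI allI)
  show "0 \<in> right_span s B"
    unfolding right_span_def by (rule CollectI) (rule exI[of _ "{}"], simp)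
  fix x assume "x \<in> right_span s B"
  then obtain T c where x: "x = (\<Sum>v\<in>T. s v (c v))" "finite T" "T \<subseteq> B"
    unfolding right_span_def by blast
  show "s x a \<in> right_span s B" for a
  proof -
    have "s x a = (\<Sum>v\<in>T. s v (c v * a))"
      by (simp add: x scale_sum_left scale_mult)
    then show ?thesis
      unfolding right_span_def mem_Collect_eq using x by (intro exI[of _ T] exI[of _ "\<lambda>v. c v * a"]) simp
  qed
  fix y assume "y \<in> right_span s B"
  then obtain T' c' where y: "y = (\<Sum>v\<in>T'. s v (c' v))" "finite T'" "T' \<subseteq> B"
    unfolding right_span_def by blast
  define e where "e v = (if v \<in> T then c v else 0)" for v
  define e' where "e' v = (if v \<in> T' then c' v else 0)" for v
  have "x = (\<Sum>v\<in>T \<union> T'. s v (e v))"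
    unfolding x(1) by (rule sum.mono_neutral_cong_left) (use x y in \<open>auto simp: e_def\<close>)
  moreover have "y = (\<Sum>v\<in>T \<union> T'. s v (e' v))"
    unfolding y(1) by (rule sum.mono_neutral_cong_left) (use x y in \<open>auto simp: e'_def\<close>)
  ultimately have "x + y = (\<Sum>v\<in>T \<union> T'. s v (e v + e' v))"
    by (simp add: scale_add_right sum.distrib)
  then show "x + y \<in> right_span s B"
    unfolding right_span_def mem_Collect_eq using x y
    by (intro exI[of _ "T \<union> T'"] exI[of _ "\<lambda>v. e v + e' v"]) simp
qed

lemma right_span_superset: "B \<subseteq> right_span s B"
proof
  fix v assume "v \<in> B"
  then show "v \<in> right_span s B"
    unfolding right_span_def mem_Collect_eq
    by (intro exI[of _ "{v}"] exI[of _ "\<lambda>_. 1"]) (simp add: scale_one)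
qed

lemma right_span_minimal:
  assumes "B \<subseteq> W" "right_subspace s W"
  shows "right_span s B \<subseteq> W"
proof
  fix x assume "x \<in> right_span s B"
  then obtain T c where x: "x = (\<Sum>v\<in>T. s v (c v))" "T \<subseteq> B"
    unfolding right_span_def by blast
  show "x \<in> W"
    unfolding x(1)
  proof (rule VF.subspace_sum[OF right_subspace_imp_subspace[OF assms(2)]])
    show "s v (c v) \<in> W" if "v \<in> T" for v
      using that x(2) assms by (auto simp: right_subspace_def)
  qed
qed

lemma right_span_insert: "right_span s (insert v B) = {w + s v c |w c. w \<in> right_span s B}"
proof
  have "w + s v 0 \<in> {w + s v c |w c. w \<in> right_span s B}" if "w \<in> B" for w
    using that right_span_superset by blast
  moreover have "0 + s v 1 \<in> {w + s v c |w c. w \<in> right_span s B}"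
    using right_subspace_span[of B] unfolding right_subspace_def by blast
  ultimately have "insert v B \<subseteq> {w + s v c |w c. w \<in> right_span s B}"
    by (auto simp: scale_one)
  then show "right_span s (insert v B) \<subseteq> {w + s v c |w c. w \<in> right_span s B}"
    by (rule right_span_minimal) (rule right_subspace_add_line[OF right_subspace_span])
  have sub: "right_subspace s (right_span s (insert v B))"
    by (rule right_subspace_span)
  have "right_span s B \<subseteq> right_span s (insert v B)" "v \<in> right_span s (insert v B)"
    using right_span_minimal[OF _ sub] right_span_superset[of "insert v B"] by blast+
  then show "{w + s v c |w c. w \<in> right_span s B} \<subseteq> right_span s (insert v B)"
    using sub unfolding right_subspace_def by blast
qed

lemma right_independent_insert:
  assumes "v \<notin> B" "right_independent s (insert v B)"
  shows "v \<notin> right_span s B" "right_independent s B"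
proof -
  show "right_independent s B"
    using assms(2) unfolding right_independent_def by blast
  show "v \<notin> right_span s B"
  proof
    assume "v \<in> right_span s B"
    then obtain T c where v: "v = (\<Sum>x\<in>T. s x (c x))" "finite T" "T \<subseteq> B"
      unfolding right_span_def by blast
    have "v \<notin> T"
      using v(3) assms(1) by blast
    then have "(\<Sum>x\<in>T. s x ((c(v := -1)) x)) = (\<Sum>x\<in>T. s x (c x))"
      by (intro sum.cong) auto
    then have "(\<Sum>x\<in>insert v T. s x ((c(v := -1)) x)) = 0"
      using v \<open>v \<notin> T\<close> by (simp add: scale_minus_right scale_one)
    then have "(c(v := -1)) v = 0"
      using assms(2) v(2,3) unfolding right_independent_def by (metis finite_insert insertI1 insert_mono)
    then show False by simp
  qed
qed

lemma right_independent_insertI: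
  assumes v: "v \<notin> right_span s B" and B: "right_independent s B"
  shows "right_independent s (insert v B)"
  unfolding right_independent_def
proof (intro allI impI, elim conjE)
  fix T c assume T: "finite T" "T \<subseteq> insert v B" and sum: "(\<Sum>x\<in>T. s x (c x)) = 0"
  show "\<forall>x\<in>T. c x = 0"
  proof (cases "v \<in> T")
    case False
    then show ?thesis
      using T sum B unfolding right_independent_def by blast
  next
    case True
    then have eq: "s v (c v) + (\<Sum>x\<in>T - {v}. s x (c x)) = 0"
      using T(1) sum by (simp add: sum.remove)
    have mem: "(\<Sum>x\<in>T - {v}. s x (c x)) \<in> right_span s B"
      unfolding right_span_def using T by blast
    have "c v = 0"
    proof (rule ccontr)
      assume "c v \<noteq> 0"
      have "s v (c v) = s (\<Sum>x\<in>T - {v}. s x (c x)) (- 1)"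
        using eq by (simp add: scale_minus_right scale_one eq_neg_iff_add_eq_0)
      then have "s v (c v) \<in> right_span s B"
        using mem right_subspace_span[of B] unfolding right_subspace_def by metis
      then have "s (s v (c v)) (inverse (c v)) \<in> right_span s B"
        using right_subspace_span[of B] unfolding right_subspace_def by blast
      then show False
        using v \<open>c v \<noteq> 0\<close> by (simp add: scale_scale_inverse)
    qed
    moreover have "(\<Sum>x\<in>T - {v}. s x (c x)) = 0"
      using eq calculation by simp
    then have "\<forall>x\<in>T - {v}. c x = 0"
      using B T unfolding right_independent_def by (metis Diff_subset_conv finite_Diff insert_is_Un)
    ultimately show ?thesis by blast
  qed
qed

lemma dim_right_span:
  "finite B \<Longrightarrow> right_independent s B \<Longrightarrow> VF.dim (right_span s B) = card B * deg"
proof (induction B rule: finite_induct)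
  case empty
  have "right_span s {} \<subseteq> {0}"
    by (rule right_span_minimal) (simp_all add: right_subspace_zero)
  then show ?case by simp
next
  case (insert v B)
  then show ?case
    using right_independent_insert[of v B] dim_add_line[OF right_subspace_span, of v B]
    by (simp add: right_span_insert)
qed

lemma right_independent_finite:
  assumes "right_independent s B"
  shows "finite B"
proof (rule ccontr)
  assume "infinite B"
  then obtain T where T: "T \<subseteq> B" "finite T" "card T = Suc (VF.dim UNIV)"
    using infinite_arbitrarily_large by blast
  then have "right_independent s T"
    using assms unfolding right_independent_def by blast
  then have "card T * deg \<le> VF.dim UNIV"
    using dim_right_span[OF T(2)] VF.dim_subset[of "right_span s T" UNIV] by simp
  then show False
    using T(3) deg_pos by (metis Suc_n_not_le_n le_trans nat_mult_le_cancel_disj mult.right_neutral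
        Suc_leI One_nat_def)
qed

text \<open>Otherwise independent sets could be extended forever, although
  \<open>card B * deg\<close> is bounded by the dimension over the subfield.\<close>

lemma exists_right_basis: "\<exists>B. right_independent s B \<and> right_span s B = UNIV"
proof (rule ccontr)
  assume no: "\<nexists>B. right_independent s B \<and> right_span s B = UNIV"
  have "\<exists>B. finite B \<and> card B = k \<and> right_independent s B" for k
  proof (induction k)
    case 0
    show ?case
      by (rule exI[of _ "{}"]) (simp add: right_independent_def)
  next
    case (Suc k)
    then obtain B where B: "finite B" "card B = k" "right_independent s B" by blast
    then obtain v where "v \<notin> right_span s B"
      using no by blast
    moreover from this have "v \<notin> B"
      using right_span_superset by blast
    ultimately show ?case
      using B right_independent_insertI by (metis card_insert_disjoint finite_insert)
  qed
  then obtain B where B: "finite B" "card B = Suc (VF.dim UNIV)" "right_independent s B"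
    by blast
  have "card B * deg \<le> VF.dim UNIV"
    using dim_right_span[OF B(1,3)] VF.dim_subset[of "right_span s B" UNIV] by simp
  moreover have "card B * 1 \<le> card B * deg"
    using deg_pos by (intro mult_le_mono2) simp
  ultimately show False
    using B(2) by simp
qed

lemma dim_eq_right_dim: "VF.dim UNIV = right_dim s * deg"
proof -
  define B where "B = (SOME B. right_independent s B \<and> right_span s B = UNIV)"
  have B: "right_independent s B \<and> right_span s B = UNIV"
    unfolding B_def by (rule someI_ex) (rule exists_right_basis)
  have "right_dim s = card B"
    using exists_right_basis by (simp add: right_dim_def B_def)
  then show ?thesis
    using dim_right_span[of B] right_independent_finite[of B] B by simp
qed

end

lemma finite_dimensional_restrict_scale:
  assumes "central_subfield \<phi>" "right_vector_space s" "right_finite_dimensional s"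
    and "finite_dimensional_vector_space (alg_scale \<phi>) ED"
  shows "\<exists>EV. finite_dimensional_vector_space (restrict_scale \<phi> s) EV"
proof -
  interpret central_subfield \<phi> by fact
  interpret right_vector_space s by fact
  interpret DF: finite_dimensional_vector_space "alg_scale \<phi>" ED by fact
  interpret VF: vector_space "restrict_scale \<phi> s"
    by (rule vector_space_restrict_scale) fact+
  obtain B where B: "finite B" "right_span s B = UNIV"
    using assms(3) by (auto simp: right_finite_dimensional_def)
  define G where "G = (\<lambda>(v, c). s v c) ` (B \<times> ED)"
  have "finite G"
    using B(1) DF.finite_Basis by (simp add: G_def)
  have mem: "s v c \<in> VF.span G" if "v \<in> B" for v c
  proof -
    have lin: "Vector_Spaces.linear (alg_scale \<phi>) (restrict_scale \<phi> s) (s v)"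
      by unfold_locales
        (simp_all add: alg_scale_def restrict_scale_def scale_add_right flip: hom_commute scale_mult)
    interpret lin: Vector_Spaces.linear "alg_scale \<phi>" "restrict_scale \<phi> s" "s v" by fact
    have "c \<in> DF.span ED"
      by (simp add: DF.span_Basis)
    then have "s v c \<in> VF.span (s v ` ED)"
      unfolding lin.span_image by blast
    moreover have "s v ` ED \<subseteq> G"
      using that by (auto simp: G_def)
    ultimately show ?thesis
      using VF.span_mono by blast
  qed
  have "x \<in> VF.span G" for x
  proof -
    have "x \<in> right_span s B"
      by (simp add: B(2))
    then obtain T c where T: "x = (\<Sum>v\<in>T. s v (c v))" "T \<subseteq> B"
      unfolding right_span_def by blast
    then show ?thesis
      using mem by (auto intro!: VF.span_sum)
  qed
  then have G: "VF.span G = UNIV" by blast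
  obtain EV where EV: "EV \<subseteq> G" "VF.independent EV" "G \<subseteq> VF.span EV"
    by (rule VF.maximal_independent_subset[of G])
  then have "VF.span EV = UNIV"
    using G VF.span_mono[of G "VF.span EV"] by (simp add: VF.span_span top.extremum_unique)
  then have "finite_dimensional_vector_space (restrict_scale \<phi> s) EV"
    using EV finite_subset[OF EV(1) \<open>finite G\<close>] by unfold_locales auto
  then show ?thesis by blast
qed

section \<open>Alternating operator spaces\<close>

text \<open>The number alpha(n,d) as the sum of \<open>k * d - 1\<close> for \<open>k\<close> from 1
  to \<open>n\<close>; each term bounds the dimension of \<open>S x\<close> at stage
  \<open>k\<close>. The natural subtraction truncates only when \<open>d = 0\<close>.\<close>

fun rank_bound :: "nat \<Rightarrow> nat \<Rightarrow> nat" where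
  "rank_bound d 0 = 0"
| "rank_bound d (Suc n) = rank_bound d n + (Suc n * d - 1)"

lemma rank_bound_mono: "m \<le> n \<Longrightarrow> rank_bound d m \<le> rank_bound d n"
  by (rule lift_Suc_mono_le) simp_all

text \<open>Ensures that \<open>rank_bound d n + 1 - n\<close> is not truncated.\<close>

lemma le_rank_bound: "d \<ge> 2 \<Longrightarrow> n \<le> rank_bound d n"
proof (induction n)
  case (Suc n)
  have "Suc n * 2 \<le> Suc n * d"
    using Suc.prems by (rule mult_le_mono2)
  then show ?case
    using Suc by simp
qed simp

lemma dim_bound_eq:
  assumes "d \<ge> 1"
  shows "dim_bound n d = int (rank_bound d n)"
proof (induction n)
  case (Suc n)
  have "Suc n * 1 \<le> Suc n * d"
    using assms by (rule mult_le_mono2)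
  then have "int (Suc n * d - 1) = int (Suc n) * int d - 1"
    by (simp add: of_nat_diff algebra_simps)
  then show ?case
    using Suc.IH by (simp add: dim_bound_def numeral_2_eq_2 algebra_simps)
qed (simp add: dim_bound_def)

locale form_on_spaces = V: extended_scalars \<phi> sV ED EV + U: right_vector_space sU
  for \<phi> :: "'f::field \<Rightarrow> 'd::division_ring"
    and sU :: "'u::ab_group_add \<Rightarrow> 'd \<Rightarrow> 'u" and sV :: "'v::ab_group_add \<Rightarrow> 'd \<Rightarrow> 'v"
    and ED EV +
  fixes b :: "'u \<Rightarrow> 'v \<Rightarrow> 'f"
  assumes bilinear: "bilinear_form \<phi> sU sV b"
begin

sublocale HF: vector_space "hom_scale \<phi> sV"
  by (rule vector_space_hom_scale) (fact V.central_subfield_axioms V.right_vector_space_axioms)+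

lemma linear_left: "Vector_Spaces.linear (restrict_scale \<phi> sU) (*) (\<lambda>x. b x y)"
  and linear_right: "Vector_Spaces.linear (restrict_scale \<phi> sV) (*) (b x)"
  using bilinear by (auto simp: bilinear_form_def)

lemma form_add_left: "b (x + x') y = b x y + b x' y"
  and form_scale_left: "b (sU x (\<phi> a)) y = a * b x y"
  using linear_left[of y] by (simp_all add: Vector_Spaces.linear_iff restrict_scale_def)

lemma form_add_right: "b x (y + y') = b x y + b x y'"
  and form_scale_right: "b x (sV y (\<phi> a)) = a * b x y"
  using linear_right[of x] by (simp_all add: Vector_Spaces.linear_iff restrict_scale_def)

lemma form_zero_left [simp]: "b 0 y = 0"
  using form_add_left[of 0 0 y] by (metis add_cancel_right_right)

lemma form_zero_right [simp]: "b x 0 = 0"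
  using form_add_right[of x 0 0] by (metis add_cancel_right_right)

text \<open>Only the second argument is restricted, \<open>x\<close> still ranging over all of
  \<open>U\<close>; so the property passes to every subset of \<open>W\<close>.\<close>

definition nondeg_on :: "'v set \<Rightarrow> bool" where
  "nondeg_on W \<longleftrightarrow> (\<forall>w\<in>W. (\<forall>x. b x w = 0) \<longrightarrow> w = 0)"

definition minor :: "'d \<Rightarrow> 'd \<Rightarrow> 'v \<Rightarrow> 'v \<Rightarrow> 'u \<Rightarrow> 'f" where
  "minor \<alpha> \<beta> y y' x = b (sU x \<alpha>) (sV y \<alpha>) * b (sU x \<beta>) (sV y' \<beta>)
     - b (sU x \<alpha>) (sV y' \<alpha>) * b (sU x \<beta>) (sV y \<beta>)"

text \<open>
  The forms \<open>y \<mapsto> b(x\<alpha>, y\<alpha>)\<close>, where \<open>\<alpha>\<close> ranges over the division ring, span a line at most on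
  \<open>W\<close>: their 2 by 2 minors vanish.
\<close>

definition tight :: "'v set \<Rightarrow> bool" where
  "tight W \<longleftrightarrow> (\<forall>x \<alpha> \<beta>. \<forall>y\<in>W. \<forall>y'\<in>W. minor \<alpha> \<beta> y y' x = 0)"

definition normed_by :: "('d \<Rightarrow> 'd) \<Rightarrow> 'v set \<Rightarrow> bool" where
  "normed_by \<tau> W \<longleftrightarrow> quadratic_conjugation \<phi> \<tau> \<and>
     (\<forall>x \<alpha>. \<forall>y\<in>W. b (sU x \<alpha>) (sV y \<alpha>) = quadratic_conjugation.norm \<phi> \<tau> \<alpha> * b x y)"

lemma normed_by_imp_tight: "normed_by \<tau> W \<Longrightarrow> tight W"
  by (simp add: normed_by_def tight_def minor_def)

lemma normed_by_unique: "normed_by \<tau> W \<Longrightarrow> normed_by \<tau>' W' \<Longrightarrow> \<tau> = \<tau>'"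
  unfolding normed_by_def using quadratic_conjugation.conj_unique by blast

text \<open>The minors with \<open>\<beta> = 1\<close> give a factor \<open>N \<alpha>\<close> with
  \<open>b (sU x \<alpha>) (sV y \<alpha>) = N \<alpha> * b x y\<close>. Then
  \<open>\<tau> \<alpha>\<close>, the quotient of \<open>N \<alpha>\<close> by
  \<open>\<alpha>\<close>, is adjoint to scaling \<open>x\<close> by \<open>\<alpha>\<close>, and
  its linearity is read off from that of \<open>b\<close>.\<close>

lemma tight_imp_norm_at:
  assumes W: "right_subspace sV W" and tight: "tight W"
    and y0: "y0 \<in> W" "b x y0 \<noteq> 0"
  shows "\<exists>\<tau>. quadratic_conjugation \<phi> \<tau> \<and>
    (\<forall>\<alpha>. \<forall>y\<in>W. b (sU x \<alpha>) (sV y \<alpha>) = quadratic_conjugation.norm \<phi> \<tau> \<alpha> * b x y)"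
proof -
  define N where "N \<alpha> = b (sU x \<alpha>) (sV y0 \<alpha>) / b x y0" for \<alpha>
  have N: "b (sU x \<alpha>) (sV y \<alpha>) = N \<alpha> * b x y" if "y \<in> W" for \<alpha> y
  proof -
    have "minor \<alpha> 1 y y0 x = 0"
      using tight that y0(1) by (simp add: tight_def)
    then show ?thesis
      using y0(2) by (simp add: minor_def N_def U.scale_one V.scale_one field_simps)
  qed
  define \<tau> where "\<tau> \<alpha> = inverse \<alpha> * \<phi> (N \<alpha>)" for \<alpha>
  have scale_W: "sV w \<delta> \<in> W" if "w \<in> W" for w \<delta>
    using W that by (simp add: right_subspace_def)
  have adjoint: "b (sU x \<alpha>) w = b x (sV w (\<tau> \<alpha>))" if "w \<in> W" for w \<alpha>
  proof (cases "\<alpha> = 0")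
    case True
    then show ?thesis by (simp add: \<tau>_def)
  next
    case False
    have "b (sU x \<alpha>) (sV (sV w (inverse \<alpha>)) \<alpha>) = N \<alpha> * b x (sV w (inverse \<alpha>))"
      using N scale_W that by blast
    then show ?thesis
      using False by (simp add: V.scale_scale_inverse \<tau>_def V.scale_mult form_scale_right)
  qed
  \<comment> \<open>The test vector is \<open>y0\<close> divided by
    \<open>\<gamma> - \<delta>\<close>, on which the two sides differ by
    \<open>b x y0\<close>.\<close>
  have separate: "\<gamma> = \<delta>" if eq: "\<And>w. w \<in> W \<Longrightarrow> b x (sV w \<gamma>) = b x (sV w \<delta>)" for \<gamma> \<delta>
  proof (rule ccontr)
    assume "\<gamma> \<noteq> \<delta>"
    define w where "w = sV y0 (inverse (\<gamma> - \<delta>))"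
    have "sV w (\<gamma> - \<delta>) = y0"
      using \<open>\<gamma> \<noteq> \<delta>\<close> by (simp add: w_def V.scale_scale_inverse)
    moreover have "sV w (\<gamma> - \<delta>) + sV w \<delta> = sV w \<gamma>"
      by (simp flip: V.scale_add_right)
    ultimately have "b x y0 + b x (sV w \<delta>) = b x (sV w \<gamma>)"
      by (metis form_add_right)
    moreover have "w \<in> W"
      using scale_W y0(1) by (simp add: w_def)
    ultimately show False
      using eq y0(2) by simp
  qed
  have conj: "quadratic_conjugation \<phi> \<tau>"
  proof
    show "\<tau> (\<alpha> + \<beta>) = \<tau> \<alpha> + \<tau> \<beta>" for \<alpha> \<beta>
      by (rule separate)
        (simp add: V.scale_add_right U.scale_add_right form_add_right form_add_left flip: adjoint)
    show "\<tau> (\<phi> a * \<alpha>) = \<phi> a * \<tau> \<alpha>" for a \<alpha>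
    proof (rule separate)
      fix w assume "w \<in> W"
      then have "b x (sV w (\<tau> (\<phi> a * \<alpha>))) = b (sU (sU x \<alpha>) (\<phi> a)) w"
        by (simp add: V.hom_commute flip: adjoint U.scale_mult)
      also have "\<dots> = b x (sV (sV w (\<tau> \<alpha>)) (\<phi> a))"
        using \<open>w \<in> W\<close> by (simp add: form_scale_left form_scale_right adjoint)
      finally show "b x (sV w (\<tau> (\<phi> a * \<alpha>))) = b x (sV w (\<phi> a * \<tau> \<alpha>))"
        by (metis V.hom_commute V.scale_mult)
    qed
    show "\<tau> 1 = 1"
      by (rule separate) (simp add: V.scale_one U.scale_one flip: adjoint)
    show "\<alpha> * \<tau> \<alpha> \<in> range \<phi>" for \<alpha>
    proof (cases "\<alpha> = 0")
      case True
      then show ?thesis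
        using V.zero_in_range by simp
    next
      case False
      then show ?thesis
        by (simp add: \<tau>_def flip: mult.assoc)
    qed
  qed
  then interpret q: quadratic_conjugation \<phi> \<tau> .
  have "q.norm \<alpha> = N \<alpha>" for \<alpha>
  proof (cases "\<alpha> = 0")
    case True
    then show ?thesis
      by (simp add: N_def q.norm_eq_zero_iff)
  next
    case False
    then have "\<phi> (q.norm \<alpha>) = \<phi> (N \<alpha>)"
      by (simp add: \<tau>_def q.hom_norm flip: mult.assoc)
    then show ?thesis by simp
  qed
  then show ?thesis
    using conj N by auto
qed

text \<open>Uniqueness of conjugations makes \<open>\<tau>\<close> independent of \<open>x\<close>
  wherever \<open>b x\<close> is nonzero on \<open>W\<close>. If \<open>b x\<close> vanishes on
  \<open>W\<close>, so does the form at \<open>sU x \<alpha>\<close>: otherwise the norm identity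
  there, applied with \<open>inverse \<alpha>\<close>, would contradict it.\<close>

lemma tight_imp_normed_by:
  assumes W: "right_subspace sV W" and tight: "tight W"
    and nondeg: "nondeg_on W" and w: "w \<in> W" "w \<noteq> 0"
  shows "\<exists>\<tau>. normed_by \<tau> W"
proof -
  obtain x0 where "b x0 w \<noteq> 0"
    using nondeg w by (auto simp: nondeg_on_def)
  then obtain \<tau> where conj: "quadratic_conjugation \<phi> \<tau>"
    using tight_imp_norm_at[OF W tight w(1)] by blast
  interpret q: quadratic_conjugation \<phi> \<tau> by fact
  have norm: "b (sU x \<alpha>) (sV y \<alpha>) = q.norm \<alpha> * b x y" if "y0 \<in> W" "b x y0 \<noteq> 0" "y \<in> W" for x \<alpha> y y0
    using tight_imp_norm_at[OF W tight that(1,2)] q.conj_unique that(3) by blast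
  have "b (sU x \<alpha>) (sV y \<alpha>) = q.norm \<alpha> * b x y" if y: "y \<in> W" for x \<alpha> y
  proof (cases "\<exists>y0\<in>W. b x y0 \<noteq> 0")
    case True
    then show ?thesis
      using norm y by blast
  next
    case False
    have "b (sU x \<alpha>) (sV y \<alpha>) = 0"
    proof (rule ccontr)
      assume ne: "b (sU x \<alpha>) (sV y \<alpha>) \<noteq> 0"
      then have "\<alpha> \<noteq> 0" by auto
      have W': "sV y \<alpha> \<in> W"
        using W y by (simp add: right_subspace_def)
      have "b (sU (sU x \<alpha>) (inverse \<alpha>)) (sV (sV y \<alpha>) (inverse \<alpha>))
          = q.norm (inverse \<alpha>) * b (sU x \<alpha>) (sV y \<alpha>)"
        by (rule norm[OF W' ne W'])
      then have "b x y \<noteq> 0"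
        using ne \<open>\<alpha> \<noteq> 0\<close> by (simp add: U.scale_scale_inverse V.scale_scale_inverse q.norm_eq_zero_iff)
      then show False
        using False y by blast
    qed
    then show ?thesis
      using False y by simp
  qed
  then show ?thesis
    unfolding normed_by_def using conj by blast
qed

text \<open>The space V_x, taken inside \<open>W\<close>. Quantifying over \<open>\<beta>\<close>
  makes it stable under scalars; quantifying over \<open>\<alpha>\<close> makes it depend only on
  the line of \<open>x\<close>.\<close>

definition annihilator :: "'u \<Rightarrow> 'v set \<Rightarrow> 'v set" where
  "annihilator x W = {v \<in> W. \<forall>\<alpha> \<beta>. b (sU x \<alpha>) (sV v \<beta>) = 0}"

lemma annihilator_subset: "annihilator x W \<subseteq> W"
  by (auto simp: annihilator_def)

lemma annihilatorD: "v \<in> annihilator x W \<Longrightarrow> b x v = 0"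
  unfolding annihilator_def by (metis (mono_tags, lifting) U.scale_one V.scale_one mem_Collect_eq)

lemma right_subspace_annihilator: "right_subspace sV W \<Longrightarrow> right_subspace sV (annihilator x W)"
  by (auto simp: right_subspace_def annihilator_def V.scale_add_left form_add_right simp flip: V.scale_mult)

definition alternating_space :: "('u \<Rightarrow> 'v) set \<Rightarrow> 'v set \<Rightarrow> bool" where
  "alternating_space S W \<longleftrightarrow> HF.subspace S \<and> S \<subseteq> right_hom sU sV \<and>
     (\<forall>f\<in>S. range f \<subseteq> W \<and> (\<forall>x. b x (f x) = 0))"

text \<open>If \<open>f x = 0\<close>, alternation at \<open>sU x \<alpha> + z\<close> and at
  \<open>z\<close> leaves only \<open>b (sU x \<alpha>) (f z) = 0\<close>.\<close>

lemma alternating_space_kernel: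
  assumes "alternating_space S W"
  shows "alternating_space {f \<in> S. f x = 0} (annihilator x W)"
proof -
  have S: "HF.subspace S" "S \<subseteq> right_hom sU sV"
    and range: "\<And>f. f \<in> S \<Longrightarrow> range f \<subseteq> W" and alt: "\<And>f x. f \<in> S \<Longrightarrow> b x (f x) = 0"
    using assms by (auto simp: alternating_space_def)
  have "HF.subspace {f \<in> S. f x = 0}"
    using S(1) by (auto simp: HF.subspace_def hom_scale_def restrict_scale_def)
  moreover have "f y \<in> annihilator x W" if f: "f \<in> S" "f x = 0" for f y
  proof -
    have add: "f (u + v) = f u + f v" and scale: "f (sU u a) = sV (f u) a" for u v a
      using S(2) f(1) by (auto simp: right_hom_def)
    have "b (sU x \<alpha>) (f z) = 0" for \<alpha> z
      using alt[OF f(1), of "sU x \<alpha> + z"] alt[OF f(1), of z]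
      by (simp add: add scale f(2) form_add_left)
    then have "b (sU x \<alpha>) (sV (f y) \<beta>) = 0" for \<alpha> \<beta>
      by (metis scale)
    then show ?thesis
      using range[OF f(1)] by (auto simp: annihilator_def)
  qed
  ultimately show ?thesis
    using S(2) alt by (auto simp: alternating_space_def)
qed

lemma rank_nullity_at:
  assumes S: "alternating_space S W"
    and img: "V.VF.dim ((\<lambda>f. f x) ` S) \<le> k" and ker: "HF.spanned_by_at_most {f \<in> S. f x = 0} l"
  shows "HF.spanned_by_at_most S (k + l)"
proof -
  interpret P: vector_space_pair "hom_scale \<phi> sV :: _ \<Rightarrow> ('u \<Rightarrow> 'v) \<Rightarrow> _" "restrict_scale \<phi> sV"
    by unfold_locales
  have "Vector_Spaces.linear (hom_scale \<phi> sV) (restrict_scale \<phi> sV) (\<lambda>f::'u \<Rightarrow> 'v. f x)"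
    by unfold_locales (simp_all add: hom_scale_def)
  then show ?thesis
    using P.spanned_by_at_most_rank_nullity[OF _ _ V.VF.spanned_if_dim_le[OF img] ker] S
    by (simp add: alternating_space_def)
qed

lemma linear_diagonal: "Vector_Spaces.linear (restrict_scale \<phi> sV) (*) (\<lambda>v. b (sU x \<alpha>) (sV v \<alpha>))"
proof -
  have "sV (sV v (\<phi> a)) \<alpha> = sV (sV v \<alpha>) (\<phi> a)" for v a
    by (simp add: V.hom_commute flip: V.scale_mult)
  then show ?thesis
    by unfold_locales (simp_all add: V.scale_add_left form_add_right restrict_scale_def
        form_scale_right algebra_simps)
qed

lemma dim_kernel_less:
  assumes W: "V.VF.subspace W" and l: "Vector_Spaces.linear (restrict_scale \<phi> sV) (*) l"
    and w: "w \<in> W" "l w \<noteq> 0"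
  shows "V.VF.dim {v \<in> W. l v = 0} < V.VF.dim W" and "V.VF.subspace {v \<in> W. l v = 0}"
proof -
  interpret l: Vector_Spaces.linear "restrict_scale \<phi> sV" "(*)" l by fact
  show sub: "V.VF.subspace {v \<in> W. l v = 0}"
    using W by (auto simp: V.VF.subspace_def l.add l.scale l.zero)
  have "{v \<in> W. l v = 0} \<subset> W"
    using w by blast
  then show "V.VF.dim {v \<in> W. l v = 0} < V.VF.dim W"
    by (intro V.VF.dim_psubset) (use W sub in \<open>metis V.VF.span_eq_iff\<close>)
qed

lemma dim_image_less:
  assumes W: "right_subspace sV W" and S: "alternating_space S W" and w: "w \<in> W" "b x w \<noteq> 0"
  shows "V.VF.dim ((\<lambda>f. f x) ` S) < V.VF.dim W"
proof -
  have "(\<lambda>f. f x) ` S \<subseteq> {v \<in> W. b x v = 0}"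
    using S by (auto simp: alternating_space_def image_subset_iff)
  then have "V.VF.dim ((\<lambda>f. f x) ` S) \<le> V.VF.dim {v \<in> W. b x v = 0}"
    by (rule V.VF.dim_subset)
  also have "\<dots> < V.VF.dim W"
    by (rule dim_kernel_less[OF V.right_subspace_imp_subspace[OF W] linear_right w])
  finally show ?thesis .
qed

text \<open>Since \<open>f\<close> commutes with scalars, \<open>f x\<close> is killed by every form
  \<open>l \<gamma>\<close>; the nonzero minor makes \<open>l \<alpha>\<close> and
  \<open>l \<beta>\<close> independent on \<open>W\<close>.\<close>

lemma dim_image_minor:
  assumes W: "right_subspace sV W" and S: "alternating_space S W"
    and y: "y \<in> W" "y' \<in> W" and minor: "minor \<alpha> \<beta> y y' x \<noteq> 0"
  shows "V.VF.dim ((\<lambda>f. f x) ` S) + 2 \<le> V.VF.dim W"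
proof -
  define l where "l \<gamma> v = b (sU x \<gamma>) (sV v \<gamma>)" for \<gamma> v
  have lin: "Vector_Spaces.linear (restrict_scale \<phi> sV) (*) (l \<gamma>)" for \<gamma>
    unfolding l_def by (rule linear_diagonal)
  have add: "l \<gamma> (u + v) = l \<gamma> u + l \<gamma> v" and scale: "l \<gamma> (sV u (\<phi> a)) = a * l \<gamma> u" for \<gamma> u v a
    using lin[of \<gamma>] by (simp_all add: Vector_Spaces.linear_iff restrict_scale_def)
  have minor': "l \<alpha> y * l \<beta> y' \<noteq> l \<alpha> y' * l \<beta> y"
    using minor by (simp add: minor_def l_def)
  note W' = V.right_subspace_imp_subspace[OF W]
  obtain w where w: "w \<in> W" "l \<alpha> w \<noteq> 0"
    using minor' y by (metis mult_zero_left)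
  define K where "K = {v \<in> W. l \<alpha> v = 0}"
  have K: "V.VF.dim K < V.VF.dim W" "V.VF.subspace K"
    unfolding K_def by (rule dim_kernel_less[OF W' lin w])+
  \<comment> \<open>The combination of \<open>y\<close> and \<open>y'\<close> killed by
    \<open>l \<alpha>\<close>; its value under \<open>l \<beta>\<close> is the minor up to
    sign.\<close>
  define u where "u = sV y (\<phi> (l \<alpha> y')) + sV y' (\<phi> (- l \<alpha> y))"
  have "u \<in> K"
    using W y by (auto simp: u_def K_def add scale right_subspace_def algebra_simps)
  moreover have "l \<beta> u \<noteq> 0"
    using minor' by (simp add: u_def add scale)
  ultimately have "V.VF.dim {v \<in> K. l \<beta> v = 0} < V.VF.dim K"
    by (rule dim_kernel_less[OF K(2) lin])
  moreover have "(\<lambda>f. f x) ` S \<subseteq> {v \<in> K. l \<beta> v = 0}"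
  proof
    fix v assume "v \<in> (\<lambda>f. f x) ` S"
    then obtain f where f: "f \<in> S" "v = f x" by blast
    have "l \<gamma> v = 0" for \<gamma>
    proof -
      have "sV v \<gamma> = f (sU x \<gamma>)"
        using f S by (auto simp: alternating_space_def right_hom_def)
      then show ?thesis
        using S f(1) by (simp add: l_def alternating_space_def)
    qed
    moreover have "v \<in> W"
      using S f by (auto simp: alternating_space_def image_subset_iff)
    ultimately show "v \<in> {v \<in> K. l \<beta> v = 0}"
      by (simp add: K_def)
  qed
  then have "V.VF.dim ((\<lambda>f. f x) ` S) \<le> V.VF.dim {v \<in> K. l \<beta> v = 0}"
    by (rule V.VF.dim_subset)
  ultimately show ?thesis
    using K(1) by linarith
qed

lemma nondeg_on_subset: "nondeg_on W \<Longrightarrow> W' \<subseteq> W \<Longrightarrow> nondeg_on W'"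
  by (auto simp: nondeg_on_def)

lemma annihilator_dim_less:
  assumes W: "right_subspace sV W" and dim: "V.VF.dim W = n * V.deg"
    and w: "w \<in> W" "w \<notin> annihilator x W"
  obtains m where "m < n" "V.VF.dim (annihilator x W) = m * V.deg"
proof -
  note A = right_subspace_annihilator[OF W, of x]
  obtain m where m: "V.VF.dim (annihilator x W) = m * V.deg"
    using V.right_subspace_dim[OF A] .
  have "annihilator x W \<subset> W"
    using w annihilator_subset by blast
  then have "V.VF.dim (annihilator x W) < V.VF.dim W"
    by (intro V.VF.dim_psubset)
      (use V.right_subspace_imp_subspace[OF W] V.right_subspace_imp_subspace[OF A] in
        \<open>metis V.VF.span_eq_iff\<close>)
  then have "m < n"
    using m dim by simp
  then show ?thesis
    using that m by blast
qed

theorem alternating_space_rank_bound: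
  assumes "right_subspace sV W" "V.VF.dim W = n * V.deg" "nondeg_on W" "alternating_space S W"
  shows "HF.spanned_by_at_most S (rank_bound V.deg n)"
  using assms
proof (induction n arbitrary: W S rule: less_induct)
  case (less n)
  show ?case
  proof (cases n)
    case 0
    then have "W \<subseteq> {0}"
      using less.prems(2) by simp
    then have "f = 0" if "f \<in> S" for f
      using less.prems(4) that by (fastforce simp: alternating_space_def)
    then have "S \<subseteq> HF.span {}"
      by auto
    then show ?thesis
      unfolding HF.spanned_by_at_most_def by (intro exI[of _ "{}"]) simp
  next
    case (Suc k)
    have "\<not> W \<subseteq> {0}"
    proof
      assume "W \<subseteq> {0}"
      then have "V.VF.dim W = 0"
        unfolding V.VF.dim_eq_0 .
      then show False
        using less.prems(2) Suc V.deg_pos by simp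
    qed
    then obtain w where w: "w \<in> W" "w \<noteq> 0" by blast
    then obtain x where x: "b x w \<noteq> 0"
      using less.prems(3) by (auto simp: nondeg_on_def)
    then have "w \<notin> annihilator x W"
      using annihilatorD by blast
    then obtain m where m: "m < n" "V.VF.dim (annihilator x W) = m * V.deg"
      using annihilator_dim_less[OF less.prems(1,2) w(1)] by blast
    have "HF.spanned_by_at_most {f \<in> S. f x = 0} (rank_bound V.deg m)"
      by (rule less.IH[OF m(1) right_subspace_annihilator[OF less.prems(1)] m(2)
            nondeg_on_subset[OF less.prems(3) annihilator_subset]
            alternating_space_kernel[OF less.prems(4)]])
    \<comment> \<open>The annihilator may have codimension larger than one; monotonicity absorbs
      this.\<close>
    moreover have "rank_bound V.deg m \<le> rank_bound V.deg k"
      using m(1) Suc by (intro rank_bound_mono) simp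
    ultimately have "HF.spanned_by_at_most {f \<in> S. f x = 0} (rank_bound V.deg k)"
      using HF.spanned_by_at_most_mono by blast
    moreover have "V.VF.dim ((\<lambda>f. f x) ` S) \<le> n * V.deg - 1"
      using dim_image_less[OF less.prems(1,4) w(1) x] less.prems(2) by simp
    ultimately have "HF.spanned_by_at_most S ((n * V.deg - 1) + rank_bound V.deg k)"
      by (intro rank_nullity_at[OF less.prems(4)])
    then show ?thesis
      by (simp add: Suc add.commute)
  qed
qed

text \<open>A minor is a quadratic polynomial along every line of \<open>U\<close>.\<close>

lemma minor_nonzero_on_line:
  assumes "minor \<alpha> \<beta> y y' x \<noteq> 0"
    and card: "finite (UNIV :: 'f set) \<longrightarrow> card (UNIV :: 'f set) \<ge> 4"
  obtains t where "t \<noteq> 0" "minor \<alpha> \<beta> y y' (x + sU z (\<phi> t)) \<noteq> 0"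
proof -
  define p where "p u \<gamma> = [:b (sU x \<gamma>) (sV u \<gamma>), b (sU z \<gamma>) (sV u \<gamma>):]" for u \<gamma>
  define q where "q = p y \<alpha> * p y' \<beta> - p y' \<alpha> * p y \<beta>"
  have "sU (x + sU z (\<phi> t)) \<gamma> = sU x \<gamma> + sU (sU z \<gamma>) (\<phi> t)" for t \<gamma>
    by (simp add: U.scale_add_left V.hom_commute flip: U.scale_mult)
  then have p: "b (sU (x + sU z (\<phi> t)) \<gamma>) (sV u \<gamma>) = poly (p u \<gamma>) t" for t \<gamma> u
    by (simp add: p_def form_add_left form_scale_left)
  have q: "minor \<alpha> \<beta> y y' (x + sU z (\<phi> t)) = poly q t" for t
    by (simp add: q_def minor_def p)
  have "poly q 0 \<noteq> 0"
    using assms(1) q[of 0] by simp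
  then have "q \<noteq> 0" by auto
  have "degree (p u \<gamma> * p u' \<gamma>') \<le> 1 + 1" for u u' \<gamma> \<gamma>'
    by (rule order_trans[OF degree_mult_le]) (intro add_mono; simp add: p_def)
  then have "degree q \<le> 2"
    unfolding q_def using degree_diff_le[of "p y \<alpha> * p y' \<beta>" 2 "p y' \<alpha> * p y \<beta>"] by (simp add: numeral_2_eq_2)
  have "\<exists>t. t \<noteq> 0 \<and> poly q t \<noteq> 0"
  proof (rule ccontr)
    assume "\<nexists>t. t \<noteq> 0 \<and> poly q t \<noteq> 0"
    then have sub: "UNIV \<subseteq> insert 0 {t. poly q t = 0}" by blast
    have fin: "finite {t. poly q t = 0}"
      by (rule poly_roots_finite[OF \<open>q \<noteq> 0\<close>])
    \<comment> \<open>The excluded value 0 and the at most two roots of \<open>q\<close> make three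
      elements, one fewer than the field has.\<close>
    have "card (UNIV :: 'f set) \<le> card (insert 0 {t. poly q t = 0})"
      using sub fin by (intro card_mono) auto
    also have "\<dots> \<le> Suc (card {t. poly q t = 0})"
      by (rule card_insert_le_m1) simp_all
    also have "\<dots> \<le> 3"
      using card_poly_roots_bound[OF \<open>q \<noteq> 0\<close>] \<open>degree q \<le> 2\<close> by simp
    finally show False
      using card finite_subset[OF sub] fin by simp
  qed
  then show ?thesis
    using that q by auto
qed

text \<open>A nonzero minor costs one more dimension of \<open>S x\<close>, and the threshold drops
  by just as much from \<open>n\<close> to \<open>n - 1\<close>. The kernel at \<open>x\<close> is
  thus still large, which leaves a hyperplane as the only possible annihilator.\<close>

lemma annihilator_if_minor:
  assumes W: "right_subspace sV W" and dim: "V.VF.dim W = n * V.deg" and nondeg: "nondeg_on W"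
    and S: "alternating_space S W" and large: "\<not> HF.spanned_by_at_most S (rank_bound V.deg n + 1 - n)"
    and deg: "V.deg \<ge> 2"
    and y: "y \<in> W" "y' \<in> W" and minor: "minor \<alpha> \<beta> y y' x \<noteq> 0"
  shows "n \<ge> 3" and "V.VF.dim (annihilator x W) = (n - 1) * V.deg"
    and "\<not> HF.spanned_by_at_most {f \<in> S. f x = 0} (rank_bound V.deg (n - 1) + 1 - (n - 1))"
proof -
  let ?d = "V.deg"
  have "\<not> (y \<in> annihilator x W \<and> y' \<in> annihilator x W)"
    using minor by (auto simp: annihilator_def minor_def)
  then obtain m where m: "m < n" "V.VF.dim (annihilator x W) = m * ?d"
    using annihilator_dim_less[OF W dim] y by metis
  obtain k where k: "n = Suc k"
    using m(1) by (cases n) auto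
  have img: "V.VF.dim ((\<lambda>f. f x) ` S) \<le> n * ?d - 2" and nd: "2 \<le> n * ?d"
    using dim_image_minor[OF W S y minor] dim by linarith+
  have ker: "HF.spanned_by_at_most {f \<in> S. f x = 0} (rank_bound ?d m)"
    by (rule alternating_space_rank_bound[OF right_subspace_annihilator[OF W] m(2)
          nondeg_on_subset[OF nondeg annihilator_subset] alternating_space_kernel[OF S]])
  have le: "k \<le> rank_bound ?d k"
    by (rule le_rank_bound[OF deg])
  have bound: "rank_bound ?d n + 1 - n = (n * ?d - 2) + (rank_bound ?d k + 1 - k)"
    using nd le by (simp add: k)
  show large': "\<not> HF.spanned_by_at_most {f \<in> S. f x = 0} (rank_bound ?d (n - 1) + 1 - (n - 1))"
    using rank_nullity_at[OF S img] large bound k by auto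
  have not_le: "\<not> rank_bound ?d m \<le> rank_bound ?d k + 1 - k"
    using HF.spanned_by_at_most_mono[OF ker subset_refl] large' k by auto
  \<comment> \<open>A smaller annihilator would bound the kernel by \<open>rank_bound ?d j\<close>
    with \<open>k = Suc j\<close>, which is within the threshold for \<open>k\<close> because
    \<open>?d \<ge> 2\<close>.\<close>
  have "m = k"
  proof (rule ccontr)
    assume "m \<noteq> k"
    then obtain j where j: "k = Suc j" "m \<le> j"
      using m(1) k by (cases k) auto
    have "Suc j * 2 \<le> Suc j * ?d"
      using deg by (rule mult_le_mono2)
    moreover have "rank_bound ?d m \<le> rank_bound ?d j"
      by (rule rank_bound_mono[OF j(2)])
    ultimately have "rank_bound ?d m \<le> rank_bound ?d k + 1 - k"
      by (simp add: j(1))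
    then show False
      using not_le by blast
  qed
  then show "V.VF.dim (annihilator x W) = (n - 1) * ?d"
    using m(2) k by simp
  \<comment> \<open>For \<open>k \<le> 1\<close> the threshold is at least the full rank bound, so
    no kernel can exceed it.\<close>
  have "k \<ge> 2"
  proof (rule ccontr)
    assume "\<not> k \<ge> 2"
    then have "rank_bound ?d k \<le> rank_bound ?d k + 1 - k"
      by simp
    then show False
      using not_le \<open>m = k\<close> by simp
  qed
  then show "n \<ge> 3"
    by (simp add: k)
qed

text \<open>Tightness on two hyperplanes says nothing about minors mixing their vectors. It is
  therefore upgraded to \<open>normed_by\<close>, a condition additive in the second
  argument.\<close>

theorem large_alternating_space_imp_tight:
  assumes deg: "V.deg \<ge> 2"
    and "right_subspace sV W" "V.VF.dim W = n * V.deg" "nondeg_on W" "alternating_space S W"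
    and "\<not> HF.spanned_by_at_most S (rank_bound V.deg n + 1 - n)"
    and "finite (UNIV :: 'f set) \<longrightarrow> card (UNIV :: 'f set) \<ge> n * V.deg"
  shows "tight W"
  using assms(2-)
proof (induction n arbitrary: W S)
  case 0
  then have "W \<subseteq> {0}"
    by simp
  then show ?case
    by (auto simp: tight_def minor_def)
next
  case (Suc k)
  show ?case
  proof (rule ccontr)
    assume "\<not> tight W"
    then obtain \<alpha> \<beta> y y' x0 where y: "y \<in> W" "y' \<in> W" and minor0: "minor \<alpha> \<beta> y y' x0 \<noteq> 0"
      by (auto simp: tight_def)
    note W = Suc.prems(1)
    note ann = annihilator_if_minor[OF Suc.prems(1-5) deg y]
    have k: "k \<ge> 2"
      using ann(1)[OF minor0] by simp
    have card: "k * V.deg \<le> card (UNIV :: 'f set) \<and> 4 \<le> card (UNIV :: 'f set)" if "finite (UNIV :: 'f set)"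
    proof -
      have "2 * 2 \<le> k * V.deg"
        using k deg by (rule mult_le_mono)
      then show ?thesis
        using Suc.prems(6) that by simp
    qed
    have normed: "\<exists>\<tau>. normed_by \<tau> (annihilator x W)" and dim: "V.VF.dim (annihilator x W) = k * V.deg"
      and nonzero: "\<not> annihilator x W \<subseteq> {0}"
      if minor: "minor \<alpha> \<beta> y y' x \<noteq> 0" for x
    proof -
      note A = right_subspace_annihilator[OF W, of x]
      note nondeg = nondeg_on_subset[OF Suc.prems(3) annihilator_subset, of x]
      show dim: "V.VF.dim (annihilator x W) = k * V.deg"
        using ann(2)[OF minor] by simp
      show nz: "\<not> annihilator x W \<subseteq> {0}"
      proof
        assume "annihilator x W \<subseteq> {0}"
        then have "V.VF.dim (annihilator x W) = 0"
          unfolding V.VF.dim_eq_0 .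
        then show False
          using dim k deg by simp
      qed
      have "tight (annihilator x W)"
        using Suc.IH[OF A dim nondeg alternating_space_kernel[OF Suc.prems(4)]] ann(3)[OF minor] card
        by simp
      then show "\<exists>\<tau>. normed_by \<tau> (annihilator x W)"
        using tight_imp_normed_by[OF A _ nondeg] nz by blast
    qed
    define H where "H = annihilator x0 W"
    obtain h where h: "h \<in> H" "h \<noteq> 0"
      using nonzero[OF minor0] by (auto simp: H_def)
    have "h \<in> W"
      using h(1) annihilator_subset by (auto simp: H_def)
    \<comment> \<open>Moving \<open>x0\<close> in the direction \<open>z\<close> makes
      \<open>h\<close> leave the annihilator, so that \<open>H1\<close> differs from
      \<open>H\<close>.\<close>
    then obtain z where z: "b z h \<noteq> 0"
      using Suc.prems(3) h(2) by (auto simp: nondeg_on_def)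
    obtain t where t: "t \<noteq> 0" "minor \<alpha> \<beta> y y' (x0 + sU z (\<phi> t)) \<noteq> 0"
      using minor_nonzero_on_line[OF minor0] card by blast
    define x1 where "x1 = x0 + sU z (\<phi> t)"
    define H1 where "H1 = annihilator x1 W"
    have minor1: "minor \<alpha> \<beta> y y' x1 \<noteq> 0"
      using t(2) by (simp add: x1_def)
    obtain \<tau> where \<tau>: "normed_by \<tau> H"
      using normed[OF minor0] by (auto simp: H_def)
    obtain \<tau>1 where \<tau>1: "normed_by \<tau>1 H1"
      using normed[OF minor1] by (auto simp: H1_def)
    have \<tau>_eq: "\<tau>1 = \<tau>"
      using normed_by_unique[OF \<tau>1 \<tau>] .
    have "b x1 h \<noteq> 0"
      using t(1) z annihilatorD[of h x0 W] h(1) by (simp add: x1_def H_def form_add_left form_scale_left)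
    then have "h \<notin> H1"
      using annihilatorD by (auto simp: H1_def)
    have H1: "right_subspace sV H1"
      unfolding H1_def by (rule right_subspace_annihilator[OF W])
    have "V.VF.dim {w + sV h c |w c. w \<in> H1} = V.VF.dim W"
      using V.dim_add_line[OF H1 \<open>h \<notin> H1\<close>] dim[OF minor1] Suc.prems(2) by (simp add: H1_def)
    moreover have "{w + sV h c |w c. w \<in> H1} \<subseteq> W"
      using W \<open>h \<in> W\<close> annihilator_subset[of x1 W] unfolding H1_def right_subspace_def by blast
    \<comment> \<open>One line outside the hyperplane \<open>H1\<close> fills \<open>W\<close>. As
      \<open>h\<close> lies in \<open>H\<close>, the norm identity holds on both summands.\<close>
    ultimately have W_eq: "{w + sV h c |w c. w \<in> H1} = W"
      by (intro V.VF.subspace_dim_equal V.right_subspace_imp_subspace V.right_subspace_add_line H1 W) auto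
    have "b (sU u \<gamma>) (sV w \<gamma>) = quadratic_conjugation.norm \<phi> \<tau> \<gamma> * b u w" if wW: "w \<in> W" for u \<gamma> w
    proof -
      obtain w1 c where w: "w = w1 + sV h c" "w1 \<in> H1"
        using wW W_eq by blast
      have "sV h c \<in> H"
        using h(1) right_subspace_annihilator[OF W, of x0] by (simp add: H_def right_subspace_def)
      then show ?thesis
        using \<tau> \<tau>1 w(2) by (simp add: w(1) \<tau>_eq normed_by_def V.scale_add_left form_add_right distrib_left)
    qed
    then have "normed_by \<tau> W"
      using \<tau> by (simp add: normed_by_def)
    then show False
      using normed_by_imp_tight \<open>\<not> tight W\<close> by blast
  qed
qed

lemma tight_if_deg_one:
  assumes "V.deg = 1"
  shows "tight W"
proof -
  have "b (sU x \<alpha>) (sV y \<alpha>) = a * a * b x y" if "\<alpha> = \<phi> a" for x y \<alpha> a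
    by (simp add: that form_scale_left form_scale_right)
  moreover have "\<exists>a. \<alpha> = \<phi> a" for \<alpha>
    using V.range_eq_UNIV_iff[OF V.fin_D] assms by blast
  ultimately have "\<exists>c. \<forall>x y. b (sU x \<alpha>) (sV y \<alpha>) = c * b x y" for \<alpha>
    by blast
  then obtain c where "b (sU x \<alpha>) (sV y \<alpha>) = c \<alpha> * b x y" for x y \<alpha>
    by metis
  then show ?thesis
    by (simp add: tight_def minor_def)
qed

end

theorem theorem1p23:
  fixes \<phi> :: "'f::field \<Rightarrow> 'd::division_ring"
    and sU :: "'u::ab_group_add \<Rightarrow> 'd \<Rightarrow> 'u"
    and sV :: "'v::ab_group_add \<Rightarrow> 'd \<Rightarrow> 'v"
    and S :: "('u \<Rightarrow> 'v) set"
    and b :: "'u \<Rightarrow> 'v \<Rightarrow> 'f"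
    and n d :: nat
  assumes "central_subfield \<phi>"
    and "finite_extension \<phi>"
    and "d = ext_degree \<phi>"
    and "right_vector_space sU" and "right_finite_dimensional sU"
    and "right_vector_space sV" and "right_finite_dimensional sV"
    and "n = right_dim sV"
    and "S \<subseteq> right_hom sU sV" and "module.subspace (hom_scale \<phi> sV) S"
    and "deeply_intransitive sV S"
    and "finite (UNIV :: 'f set) \<longrightarrow> card (UNIV :: 'f set) \<ge> n * d"
    and "alternator \<phi> sU sV S b" and "right_nondegenerate b"
    and "int (vector_space.dim (hom_scale \<phi> sV) S)
           \<ge> dim_bound n d - int n + max (4 - int d) 2"
  shows "quadratic_type \<phi> \<and>
    (\<forall>\<sigma> e. associated_pair \<phi> \<sigma> e \<longrightarrow>
       (\<exists>!B. sesquilinear sU sV \<sigma> B \<and> right_nondegenerate B \<and>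
             b = (\<lambda>x y. e (B x y)))) \<and>
    S \<subseteq> alternating_homs sU sV b"
proof -
  interpret C: central_subfield \<phi> by fact
  obtain ED where fin_D: "finite_dimensional_vector_space (alg_scale \<phi>) ED"
    using assms(2) by (auto simp: finite_extension_def)
  obtain EV where fin_V: "finite_dimensional_vector_space (restrict_scale \<phi> sV) EV"
    using finite_dimensional_restrict_scale[OF assms(1,6,7) fin_D] by blast
  have V: "extended_scalars \<phi> sV ED EV"
    using assms(1,6) fin_D fin_V by (simp add: extended_scalars_def extended_scalars_axioms_def)
  have bilinear: "bilinear_form \<phi> sU sV b"
    using assms(13) by (simp add: alternator_def)
  interpret form_on_spaces \<phi> sU sV ED EV b
    using V assms(4) bilinear by (simp add: form_on_spaces_def form_on_spaces_axioms_def)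
  have dim: "V.VF.dim UNIV = n * V.deg"
    using V.dim_eq_right_dim assms(8) by simp
  have d: "d = V.deg" "d \<ge> 1"
    using assms(3) V.deg_pos by auto
  have S: "alternating_space S UNIV"
    using assms(9,10,13) by (simp add: alternating_space_def alternator_def)
  have nondeg: "nondeg_on UNIV"
    using assms(14) by (auto simp: nondeg_on_def right_nondegenerate_def)
  have large: "int (HF.dim S) \<ge> int (rank_bound d n) - int n + max (4 - int d) 2"
    using assms(15) dim_bound_eq[OF d(2)] by simp
  \<comment> \<open>For \<open>n = 0\<close> the rank bound is 0 while \<open>large\<close> demands
    dimension at least 2.\<close>
  have "n \<noteq> 0"
  proof
    assume "n = 0"
    then have "HF.dim S \<le> 0"
      using HF.dim_le_if_spanned[OF alternating_space_rank_bound[OF V.right_subspace_UNIV dim nondeg S]] d(1)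
      by simp
    then show False
      using large \<open>n = 0\<close> by simp
  qed
  have tight: "tight UNIV"
  proof (cases "d = 1")
    case True
    then show ?thesis
      using tight_if_deg_one d(1) by simp
  next
    case False
    then have deg: "V.deg \<ge> 2"
      using d by simp
    show ?thesis
    proof (rule large_alternating_space_imp_tight[OF deg V.right_subspace_UNIV dim nondeg S])
      \<comment> \<open>The maximum in \<open>large\<close> is at least 2, one above the constant 1
        of the threshold.\<close>
      show "\<not> HF.spanned_by_at_most S (rank_bound V.deg n + 1 - n)"
      proof
        assume "HF.spanned_by_at_most S (rank_bound V.deg n + 1 - n)"
        then have "HF.dim S \<le> rank_bound d n + 1 - n"
          using HF.dim_le_if_spanned d(1) by simp
        moreover have "n \<le> rank_bound d n"
          using le_rank_bound deg d(1) by simp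
        ultimately show False
          using large by linarith
      qed
      show "finite (UNIV :: 'f set) \<longrightarrow> card (UNIV :: 'f set) \<ge> n * V.deg"
        using assms(12) d(1) by simp
    qed
  qed
  have "\<exists>w::'v. w \<noteq> 0"
  proof (rule ccontr)
    assume "\<nexists>w::'v. w \<noteq> 0"
    then have "(UNIV :: 'v set) \<subseteq> {0}"
      by auto
    then have "V.VF.dim UNIV = 0"
      unfolding V.VF.dim_eq_0 .
    then show False
      using dim \<open>n \<noteq> 0\<close> V.deg_pos by simp
  qed
  then obtain w :: 'v where "w \<noteq> 0" by blast
  then obtain \<tau> where \<tau>: "normed_by \<tau> UNIV"
    using tight_imp_normed_by[OF V.right_subspace_UNIV tight nondeg UNIV_I] by blast
  then interpret q: quadratic_conjugation \<phi> \<tau>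
    by (simp add: normed_by_def)
  have norm: "b (sU x \<alpha>) (sV y \<alpha>) = q.norm \<alpha> * b x y" for x y \<alpha>
    using \<tau> by (simp add: normed_by_def)
  have "quadratic_type \<phi>"
    by (rule q.quadratic_type_if_conjugation[OF fin_D])
  moreover have "\<exists>!B. sesquilinear sU sV \<sigma> B \<and> right_nondegenerate B \<and> b = (\<lambda>x y. e (B x y))"
    if "associated_pair \<phi> \<sigma> e" for \<sigma> e
    by (rule q.sesquilinear_representation[OF fin_D assms(4,6) bilinear norm assms(14) that])
  moreover have "S \<subseteq> alternating_homs sU sV b"
    using assms(9,13) by (auto simp: alternating_homs_def alternator_def)
  ultimately show ?thesis
    by blast
qed

end
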